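(* Let $a\in C_{2\pi}$ be a real valued function and let $f$ be a (complex valued) continuous function on the spectrum of $T(a)$. Then $$f(T(a))=T(f\circ a)+K,$$ where $K$ is a compact operator on $\ell^2$. If $f$ takes real values on the spectrum of $T(a)$, then $K$ is self-adjoint and $\mathrm{sp}(f(T(a)))=\mathrm{sp}(T(f\circ a))$.
   Context: $\ell^2$ is the complex Hilbert space of square-summable sequences indexed by the positive integers. $C_{2\pi}$ is the set of continuous functions $a:[0,2\pi]\to\mathbb C$ with $a(0)=a(2\pi)$. For $a\in C_{2\pi}$ with Fourier series $\sum_{k\in\mathbb Z}a_k e^{\mathrm{i}kt}$, $T(a)$ denotes the bounded operator on $\ell^2$ represented by the semi-infinite Toeplitz matrix with entries $(T(a))_{i,j}=a_{j-i}$, $i,j\ge 1$. For real valued $a$, $T(a)$ is self-adjoint and its spectrum contains the range of $a$. For a bounded self-adjoint operator $A$ and $f$ continuous on the spectrum $\mathrm{sp}(A)$, $f(A)$ is defined by the continuous functional calculus. *)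

theory Defs
  imports "HOL-Analysis.Analysis" "HOL-Computational_Algebra.Polynomial"
begin

section \<open>The complex Hilbert space of square-summable sequences\<close>

text \<open>Coordinates are counted from 0: coordinate \<open>n\<close> is the coordinate of the positive integer
  \<open>n + 1\<close>. Toeplitz matrices depend only on the difference of the indices, so they are not affected
  by this shift.\<close>

typedef ell2 = "{x :: nat \<Rightarrow> complex. summable (\<lambda>n. (cmod (x n))\<^sup>2)}"
  morphisms ell2_nth Abs_ell2
  by (rule exI[of _ "\<lambda>_. 0"]) simp

setup_lifting type_definition_ell2

lemma summable_ell2_nth: "summable (\<lambda>n. (cmod (ell2_nth x n))\<^sup>2)"
  using ell2_nth[of x] by simp

lemma ell2_eqI: "(\<And>n. ell2_nth x n = ell2_nth y n) \<Longrightarrow> x = y"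
  by (simp add: ell2_nth_inject[symmetric] fun_eq_iff)

lemma summable_cmod_sq_add:
  assumes "summable (\<lambda>n. (cmod (x n))\<^sup>2)" "summable (\<lambda>n. (cmod (y n))\<^sup>2)"
  shows "summable (\<lambda>n. (cmod (x n + y n))\<^sup>2)"
proof (rule summable_comparison_test')
  show "summable (\<lambda>n. 2 * (cmod (x n))\<^sup>2 + 2 * (cmod (y n))\<^sup>2)"
    by (intro summable_add summable_mult assms)
  fix n
  have "(cmod (x n + y n))\<^sup>2 \<le> (cmod (x n) + cmod (y n))\<^sup>2"
    by (intro power_mono norm_triangle_ineq) simp
  also have "\<dots> \<le> 2 * (cmod (x n))\<^sup>2 + 2 * (cmod (y n))\<^sup>2"
    using sum_squares_bound[of "cmod (x n)" "cmod (y n)"] by (simp add: power2_sum)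
  finally show "norm ((cmod (x n + y n))\<^sup>2) \<le> 2 * (cmod (x n))\<^sup>2 + 2 * (cmod (y n))\<^sup>2"
    by simp
qed

lemma summable_cmod_sq_mult:
  assumes "summable (\<lambda>n. (cmod (x n))\<^sup>2)"
  shows "summable (\<lambda>n. (cmod (c * x n))\<^sup>2)"
  using assms by (simp add: norm_mult power_mult_distrib summable_mult)

lemma summable_norm_mult_ell2:
  "summable (\<lambda>n. cmod (ell2_nth x n) * cmod (ell2_nth y n))"
proof (rule summable_comparison_test')
  show "summable (\<lambda>n. (cmod (ell2_nth x n))\<^sup>2 + (cmod (ell2_nth y n))\<^sup>2)"
    by (intro summable_add summable_ell2_nth)
  fix n
  have "2 * (cmod (ell2_nth x n) * cmod (ell2_nth y n))
      \<le> (cmod (ell2_nth x n))\<^sup>2 + (cmod (ell2_nth y n))\<^sup>2"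
    using sum_squares_bound[of "cmod (ell2_nth x n)" "cmod (ell2_nth y n)"] by simp
  moreover have "0 \<le> cmod (ell2_nth x n) * cmod (ell2_nth y n)" by simp
  ultimately show "norm (cmod (ell2_nth x n) * cmod (ell2_nth y n))
      \<le> (cmod (ell2_nth x n))\<^sup>2 + (cmod (ell2_nth y n))\<^sup>2"
    by (simp only: real_norm_def abs_of_nonneg)
qed

lemma summable_inner_ell2: "summable (\<lambda>n. inner (ell2_nth x n) (ell2_nth y n))"
  by (rule summable_comparison_test'[OF summable_norm_mult_ell2[of x y]])
     (simp add: Cauchy_Schwarz_ineq2)

lift_definition scaleC_ell2 :: "complex \<Rightarrow> ell2 \<Rightarrow> ell2"  (infixr "*\<^sub>C" 75)
  is "\<lambda>c x n. c * x n"
  by (simp add: summable_cmod_sq_mult)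

definition cinner_ell2 :: "ell2 \<Rightarrow> ell2 \<Rightarrow> complex"
  where "cinner_ell2 x y = (\<Sum>n. ell2_nth x n * cnj (ell2_nth y n))"

text \<open>The library has no class of complex Hilbert spaces, so the norm and the topology come from the
  underlying real Hilbert space, whose inner product is the real part of \<open>cinner_ell2\<close>.\<close>

instantiation ell2 :: real_inner
begin

lift_definition zero_ell2 :: ell2 is "\<lambda>_. 0" by simp

lift_definition plus_ell2 :: "ell2 \<Rightarrow> ell2 \<Rightarrow> ell2" is "\<lambda>x y n. x n + y n"
  by (simp add: summable_cmod_sq_add)

lift_definition uminus_ell2 :: "ell2 \<Rightarrow> ell2" is "\<lambda>x n. - x n" by simp

lift_definition minus_ell2 :: "ell2 \<Rightarrow> ell2 \<Rightarrow> ell2" is "\<lambda>x y n. x n - y n"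
  subgoal for x y using summable_cmod_sq_add[of x "\<lambda>n. - y n"] by simp
  done

lift_definition scaleR_ell2 :: "real \<Rightarrow> ell2 \<Rightarrow> ell2" is "\<lambda>r x n. r *\<^sub>R x n"
  by (simp add: scaleR_conv_of_real summable_cmod_sq_mult)

definition inner_ell2 :: "ell2 \<Rightarrow> ell2 \<Rightarrow> real"
  where "inner_ell2 x y = (\<Sum>n. inner (ell2_nth x n) (ell2_nth y n))"

definition norm_ell2 :: "ell2 \<Rightarrow> real"
  where "norm_ell2 x = sqrt (\<Sum>n. (cmod (ell2_nth x n))\<^sup>2)"

definition sgn_ell2 :: "ell2 \<Rightarrow> ell2"
  where "sgn_ell2 x = inverse (norm x) *\<^sub>R x"

definition dist_ell2 :: "ell2 \<Rightarrow> ell2 \<Rightarrow> real"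
  where "dist_ell2 x y = norm (x - y)"

definition uniformity_ell2 :: "(ell2 \<times> ell2) filter"
  where "uniformity_ell2 = (INF e\<in>{0<..}. principal {(x, y). dist x y < e})"

definition open_ell2 :: "ell2 set \<Rightarrow> bool"
  where "open_ell2 U \<longleftrightarrow> (\<forall>x\<in>U. eventually (\<lambda>(x', y). x' = x \<longrightarrow> y \<in> U) uniformity)"

instance
proof
  fix x y z :: ell2 and r s :: real and U :: "ell2 set"
  show "x + y + z = x + (y + z)" by transfer (simp add: add.assoc)
  show "x + y = y + x" by transfer (simp add: add.commute)
  show "0 + x = x" by transfer simp
  show "- x + x = 0" by transfer simp
  show "x - y = x + - y" by transfer simp
  show "r *\<^sub>R (x + y) = r *\<^sub>R x + r *\<^sub>R y" by transfer (simp add: scaleR_add_right)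
  show "(r + s) *\<^sub>R x = r *\<^sub>R x + s *\<^sub>R x" by transfer (simp add: scaleR_add_left)
  show "r *\<^sub>R s *\<^sub>R x = (r * s) *\<^sub>R x" by transfer simp
  show "1 *\<^sub>R x = x" by transfer simp
  show "dist x y = norm (x - y)" by (rule dist_ell2_def)
  show "sgn x = inverse (norm x) *\<^sub>R x" by (rule sgn_ell2_def)
  show "uniformity = (INF e\<in>{0<..}. principal {(x, y :: ell2). dist x y < e})"
    by (rule uniformity_ell2_def)
  show "open U \<longleftrightarrow> (\<forall>x\<in>U. \<forall>\<^sub>F (x', y) in uniformity. x' = x \<longrightarrow> y \<in> U)"
    by (rule open_ell2_def)
  show "inner x y = inner y x" by (simp add: inner_ell2_def inner_commute)
  show "inner (x + y) z = inner x z + inner y z"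
    by (simp add: inner_ell2_def plus_ell2.rep_eq inner_add_left
        suminf_add[OF summable_inner_ell2 summable_inner_ell2])
  show "inner (r *\<^sub>R x) y = r * inner x y"
    by (simp only: inner_ell2_def scaleR_ell2.rep_eq inner_scaleR_left
        suminf_mult[OF summable_inner_ell2])
  show "0 \<le> inner x x"
    by (simp add: inner_ell2_def suminf_nonneg summable_inner_ell2)
  show "inner x x = 0 \<longleftrightarrow> x = 0"
  proof
    assume "inner x x = 0"
    then have "\<forall>n. inner (ell2_nth x n) (ell2_nth x n) = 0"
      unfolding inner_ell2_def
      by (subst (asm) suminf_eq_zero_iff) (auto intro: summable_inner_ell2)
    then show "x = 0" by (intro ell2_eqI) (simp add: zero_ell2.rep_eq)
  qed (simp add: inner_ell2_def zero_ell2.rep_eq)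
  show "norm x = sqrt (inner x x)"
    by (simp add: norm_ell2_def inner_ell2_def power2_norm_eq_inner)
qed

end

lemma norm_ell2_nth_le: "cmod (ell2_nth x n) \<le> norm x"
proof -
  have "(cmod (ell2_nth x n))\<^sup>2 \<le> (\<Sum>n. (cmod (ell2_nth x n))\<^sup>2)"
    using sum_le_suminf[OF summable_ell2_nth[of x], of "{n}"] by simp
  then show ?thesis by (simp add: norm_ell2_def real_le_rsqrt)
qed

lemma sum_cmod_sq_le_norm_ell2: "(\<Sum>n<N. (cmod (ell2_nth x n))\<^sup>2) \<le> (norm x)\<^sup>2"
  using sum_le_suminf[OF summable_ell2_nth[of x], of "{..<N}"]
  by (simp add: norm_ell2_def suminf_nonneg summable_ell2_nth)

instance ell2 :: complete_space
proof
  fix X :: "nat \<Rightarrow> ell2"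
  assume X: "Cauchy X"
  have "Cauchy (\<lambda>k. ell2_nth (X k) n)" for n
  proof (rule metric_CauchyI)
    fix e :: real assume "e > 0"
    then obtain M where M: "\<forall>m\<ge>M. \<forall>k\<ge>M. dist (X m) (X k) < e"
      using X unfolding Cauchy_def by blast
    have "dist (ell2_nth (X m) n) (ell2_nth (X k) n) \<le> dist (X m) (X k)" for m k
      using norm_ell2_nth_le[of "X m - X k" n] by (simp add: dist_norm minus_ell2.rep_eq)
    then show "\<exists>M. \<forall>m\<ge>M. \<forall>k\<ge>M. dist (ell2_nth (X m) n) (ell2_nth (X k) n) < e"
      using M by (meson le_less_trans)
  qed
  then have "\<forall>n. \<exists>l. (\<lambda>k. ell2_nth (X k) n) \<longlonglongrightarrow> l"
    using Cauchy_convergent convergent_def by blast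
  then obtain l where l: "\<And>n. (\<lambda>k. ell2_nth (X k) n) \<longlonglongrightarrow> l n" by metis
  have bound: "\<exists>M. \<forall>m\<ge>M. \<forall>N. (\<Sum>n<N. (cmod (ell2_nth (X m) n - l n))\<^sup>2) \<le> e\<^sup>2"
    if "e > 0" for e :: real
  proof -
    obtain M where M: "\<forall>m\<ge>M. \<forall>k\<ge>M. dist (X m) (X k) < e"
      using X \<open>e > 0\<close> unfolding Cauchy_def by blast
    have "(\<Sum>n<N. (cmod (ell2_nth (X m) n - l n))\<^sup>2) \<le> e\<^sup>2" if "m \<ge> M" for m N
    proof (rule LIMSEQ_le_const2)
      show "(\<lambda>k. \<Sum>n<N. (cmod (ell2_nth (X m) n - ell2_nth (X k) n))\<^sup>2)
          \<longlonglongrightarrow> (\<Sum>n<N. (cmod (ell2_nth (X m) n - l n))\<^sup>2)"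
        by (intro tendsto_intros l)
      have "(\<Sum>n<N. (cmod (ell2_nth (X m) n - ell2_nth (X k) n))\<^sup>2) \<le> e\<^sup>2" if "k \<ge> M" for k
      proof -
        have "(\<Sum>n<N. (cmod (ell2_nth (X m) n - ell2_nth (X k) n))\<^sup>2) \<le> (norm (X m - X k))\<^sup>2"
          using sum_cmod_sq_le_norm_ell2[where x = "X m - X k"] by (simp add: minus_ell2.rep_eq)
        also have "\<dots> \<le> e\<^sup>2"
          using M \<open>m \<ge> M\<close> that by (intro power_mono) (auto simp: dist_norm less_imp_le)
        finally show ?thesis .
      qed
      then show "\<exists>K. \<forall>k\<ge>K. (\<Sum>n<N. (cmod (ell2_nth (X m) n - ell2_nth (X k) n))\<^sup>2) \<le> e\<^sup>2"
        by blast
    qed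
    then show ?thesis by blast
  qed
  have summ: "summable (\<lambda>n. (cmod (u n))\<^sup>2)" if "\<forall>N. (\<Sum>n<N. (cmod (u n))\<^sup>2) \<le> c"
    for u :: "nat \<Rightarrow> complex" and c
    by (rule bounded_imp_summable[where B = c])
      (simp, simp only: that flip: lessThan_Suc_atMost)
  obtain M where M: "\<forall>N. (\<Sum>n<N. (cmod (ell2_nth (X M) n - l n))\<^sup>2) \<le> 1\<^sup>2"
    using bound[of 1] by auto
  have "summable (\<lambda>n. (cmod (ell2_nth (X M) n - l n))\<^sup>2)" by (rule summ[OF M])
  then have "summable (\<lambda>n. (cmod (- 1 * (ell2_nth (X M) n - l n)))\<^sup>2)"
    by (rule summable_cmod_sq_mult)
  from summable_cmod_sq_add[OF this summable_ell2_nth[of "X M"]]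
  have "summable (\<lambda>n. (cmod (l n))\<^sup>2)" by simp
  then have L: "ell2_nth (Abs_ell2 l) = l" by (simp add: Abs_ell2_inverse)
  have "X \<longlonglongrightarrow> Abs_ell2 l"
  proof (rule LIMSEQ_I)
    fix e :: real assume "e > 0"
    then obtain M where M: "\<forall>m\<ge>M. \<forall>N. (\<Sum>n<N. (cmod (ell2_nth (X m) n - l n))\<^sup>2) \<le> (e / 2)\<^sup>2"
      using bound[of "e / 2"] by auto
    have "norm (X m - Abs_ell2 l) < e" if "m \<ge> M" for m
    proof -
      have "(\<Sum>n. (cmod (ell2_nth (X m) n - l n))\<^sup>2) \<le> (e / 2)\<^sup>2"
        using M that by (intro suminf_le_const summ[where c = "(e / 2)\<^sup>2"]) auto
      then have "norm (X m - Abs_ell2 l) \<le> sqrt ((e / 2)\<^sup>2)"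
        unfolding norm_ell2_def minus_ell2.rep_eq L by (rule real_sqrt_le_mono)
      then have "norm (X m - Abs_ell2 l) \<le> e / 2"
        using \<open>e > 0\<close> by (simp only: real_sqrt_abs)
      then show ?thesis using \<open>e > 0\<close> by simp
    qed
    then show "\<exists>M. \<forall>m\<ge>M. norm (X m - Abs_ell2 l) < e" by blast
  qed
  then show "convergent X" by (auto simp: convergent_def)
qed

instance ell2 :: banach ..

lemma inner_ell2_eq_Re_cinner: "inner x y = Re (cinner_ell2 x y)"
proof -
  have "summable (\<lambda>n. ell2_nth x n * cnj (ell2_nth y n))"
    by (rule summable_comparison_test'[OF summable_norm_mult_ell2[of x y]]) (simp add: norm_mult)
  then have "Re (cinner_ell2 x y) = (\<Sum>n. Re (ell2_nth x n * cnj (ell2_nth y n)))"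
    unfolding cinner_ell2_def by (rule bounded_linear.suminf[OF bounded_linear_Re])
  then show ?thesis by (simp add: inner_ell2_def inner_complex_def)
qed


section \<open>Bounded operators\<close>

definition bounded_op :: "(ell2 \<Rightarrow> ell2) \<Rightarrow> bool"
  where "bounded_op A \<longleftrightarrow> bounded_linear A \<and> (\<forall>c x. A (c *\<^sub>C x) = c *\<^sub>C A x)"

definition self_adjoint :: "(ell2 \<Rightarrow> ell2) \<Rightarrow> bool"
  where "self_adjoint A \<longleftrightarrow>
    bounded_op A \<and> (\<forall>x y. cinner_ell2 (A x) y = cinner_ell2 x (A y))"

definition compact_op :: "(ell2 \<Rightarrow> ell2) \<Rightarrow> bool"
  where "compact_op A \<longleftrightarrow> bounded_op A \<and> compact (closure (A ` cball 0 1))"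

definition invertible_op :: "(ell2 \<Rightarrow> ell2) \<Rightarrow> bool"
  where "invertible_op A \<longleftrightarrow>
    bounded_op A \<and> (\<exists>B. bounded_op B \<and> B \<circ> A = id \<and> A \<circ> B = id)"

definition spectrum :: "(ell2 \<Rightarrow> ell2) \<Rightarrow> complex set"
  where "spectrum A = {z. \<not> invertible_op (\<lambda>x. A x - z *\<^sub>C x)}"


section \<open>Continuous functional calculus\<close>

definition poly_op :: "complex poly \<Rightarrow> (ell2 \<Rightarrow> ell2) \<Rightarrow> ell2 \<Rightarrow> ell2"
  where "poly_op p A x = (\<Sum>i\<le>degree p. coeff p i *\<^sub>C (A ^^ i) x)"

text \<open>For a bounded self-adjoint \<open>A\<close> the map \<open>p \<mapsto> p(A)\<close> is isometric from the polynomials, with the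
  supremum norm over the spectrum, to the bounded operators with the operator norm, and the spectrum
  is a compact set of real numbers, on which polynomials are uniformly dense in the continuous
  functions. So for \<open>f\<close> continuous on the spectrum there is exactly one operator as described
  here: the functional calculus is the continuous extension of \<open>p \<mapsto> p(A)\<close>.\<close>

definition cont_fun_calc :: "(complex \<Rightarrow> complex) \<Rightarrow> (ell2 \<Rightarrow> ell2) \<Rightarrow> ell2 \<Rightarrow> ell2"
  where "cont_fun_calc f A = (THE B. bounded_op B \<and>
    (\<exists>p :: nat \<Rightarrow> complex poly.
      uniform_limit (spectrum A) (\<lambda>n. poly (p n)) f sequentially \<and>
      (\<lambda>n. onorm (\<lambda>x. poly_op (p n) A x - B x)) \<longlonglongrightarrow> 0))"


section \<open>Toeplitz operators\<close>

definition C2pi :: "(real \<Rightarrow> complex) set"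
  where "C2pi = {a. continuous_on {0..2*pi} a \<and> a 0 = a (2*pi)}"

definition fourier_coeff :: "(real \<Rightarrow> complex) \<Rightarrow> int \<Rightarrow> complex"
  where "fourier_coeff a k =
    integral {0..2*pi} (\<lambda>t. a t * exp (- \<i> * of_int k * of_real t)) / of_real (2*pi)"

text \<open>The matrix with entries \<open>a\<^sub>j\<^sub>-\<^sub>i\<close> (row \<open>i\<close>, column \<open>j\<close>) acting on column vectors. For
  \<open>a\<close> in \<open>C2pi\<close> all series converge and the resulting sequence is square-summable.\<close>

definition toeplitz :: "(real \<Rightarrow> complex) \<Rightarrow> ell2 \<Rightarrow> ell2"
  where "toeplitz a x = Abs_ell2 (\<lambda>i. \<Sum>j. fourier_coeff a (int j - int i) * ell2_nth x j)"

end

theory Submission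
  imports Defs "HOL-Computational_Algebra.Fundamental_Theorem_Algebra"
begin

text \<open>Three facts are combined. First, for a self-adjoint operator \<open>A\<close> the spectral radius is the norm,
  so \<open>\<parallel>p(A)\<parallel>\<close> is at most the supremum of \<open>\<bar>p\<bar>\<close> on the spectrum, and the functional calculus exists as a
  continuous extension, with \<open>sp (f(A)) = f(sp A)\<close>. Second, the spectrum of a Toeplitz operator with
  real symbol \<open>a\<close> is exactly the range of \<open>a\<close>: the numerical range bounds it from above, and a lower
  bound for \<open>T(b)\<close> forces the same lower bound for \<open>\<bar>b\<bar>\<close>. Third, \<open>T(a) T(b) - T(a b)\<close> is compact, being
  a norm limit of finite rank operators. By induction \<open>p(T(a)) - T(p \<circ> a)\<close> is compact for every
  polynomial \<open>p\<close>; if \<open>p\<close> tends to \<open>f\<close> uniformly on the spectrum, this converges in norm to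
  \<open>f(T(a)) - T(f \<circ> a)\<close>. For real \<open>f\<close> both spectra are the range of \<open>f \<circ> a\<close>.\<close>

section \<open>Bounded operators on the sequence space\<close>

text \<open>Lower bounds carry the spectral arguments, in place of eigenvectors or spectral
  measures. Outside the spectrum, \<open>A x - z *\<^sub>C x\<close> has norm at least
  \<open>c * norm x\<close> for some \<open>c > 0\<close>; conversely, coercivity of a rotated
  \<open>A - z\<close> gives invertibility by a contraction argument. The obstacle with symbols is
  that \<open>T(b)\<close> is multiplication by \<open>b\<close> cut down to half of the
  frequencies, so vectors only supply test functions with frequencies \<open>0, -1, -2, ...\<close>.
  Multiplication by one exponential moves every trigonometric polynomial into that range without
  changing its modulus, and only moduli enter the lower bound. For the calculus, the decisive fact
  is that every polynomial close to \<open>f\<close> on the spectrum is equally close to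
  \<open>f(A)\<close> in norm. Each property of \<open>f(A)\<close> is then checked on a freely
  chosen polynomial, up to an error that tends to 0.\<close>

lemmas ell2_nth_simps [simp] =
  zero_ell2.rep_eq plus_ell2.rep_eq minus_ell2.rep_eq uminus_ell2.rep_eq
  scaleC_ell2.rep_eq scaleR_ell2.rep_eq

lemma scaleC_simps [simp]:
  "0 *\<^sub>C x = 0" "c *\<^sub>C 0 = 0" "1 *\<^sub>C x = x" "c *\<^sub>C d *\<^sub>C x = (c * d) *\<^sub>C x"
  by (auto intro!: ell2_eqI)

lemma scaleC_distribs:
  "c *\<^sub>C (x + y) = c *\<^sub>C x + c *\<^sub>C y" "c *\<^sub>C (x - y) = c *\<^sub>C x - c *\<^sub>C y"
  "(c + d) *\<^sub>C x = c *\<^sub>C x + d *\<^sub>C x" "(c - d) *\<^sub>C x = c *\<^sub>C x - d *\<^sub>C x"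
  by (auto intro!: ell2_eqI simp: algebra_simps)

lemma scaleC_minus: "(- c) *\<^sub>C x = - (c *\<^sub>C x)"
  by (auto intro!: ell2_eqI)

lemma scaleC_of_real: "complex_of_real r *\<^sub>C x = r *\<^sub>R x"
  by (auto intro!: ell2_eqI simp: scaleR_conv_of_real)

lemma norm_ell2_sq: "(norm x)\<^sup>2 = (\<Sum>n. (cmod (ell2_nth x n))\<^sup>2)"
  by (simp add: norm_ell2_def suminf_nonneg summable_ell2_nth)

lemma norm_scaleC: "norm (c *\<^sub>C x) = cmod c * norm x"
proof -
  have "(norm (c *\<^sub>C x))\<^sup>2 = (cmod c * norm x)\<^sup>2"
    by (simp add: norm_ell2_sq norm_mult power_mult_distrib suminf_mult summable_ell2_nth)
  then show ?thesis by (simp add: power2_eq_iff_nonneg)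
qed

lemma inner_scaleC_left: "inner (c *\<^sub>C x) y = inner x (cnj c *\<^sub>C y)"
proof -
  have "inner (c * a) b = inner a (cnj c * b)" for a b :: complex
    by (simp add: inner_complex_def algebra_simps)
  then show ?thesis by (simp add: inner_ell2_def)
qed

lemma bounded_linear_scaleC: "bounded_linear (\<lambda>x. c *\<^sub>C x)"
  by (rule bounded_linear_intro[where K = "cmod c"])
     (auto intro!: ell2_eqI simp: norm_scaleC algebra_simps)

lemma bounded_linear_scaleC_left: "bounded_linear (\<lambda>c. c *\<^sub>C x)"
  by (rule bounded_linear_intro[where K = "norm x"])
     (auto intro!: ell2_eqI simp: norm_scaleC algebra_simps)

lemma summable_cinner: "summable (\<lambda>n. ell2_nth x n * cnj (ell2_nth y n))"
  by (rule summable_comparison_test'[OF summable_norm_mult_ell2[of x y]]) (simp add: norm_mult)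

lemma cinner_scaleC_left: "cinner_ell2 (c *\<^sub>C x) y = c * cinner_ell2 x y"
  by (simp add: cinner_ell2_def mult.assoc suminf_mult summable_cinner)

lemma cinner_conv_inner: "cinner_ell2 x y = Complex (inner x y) (inner ((- \<i>) *\<^sub>C x) y)"
  by (simp add: complex_eq_iff inner_ell2_eq_Re_cinner cinner_scaleC_left)

lemma bounded_opD:
  assumes "bounded_op A"
  shows "bounded_linear A" "A (c *\<^sub>C x) = c *\<^sub>C A x" "A (x + y) = A x + A y" "A (x - y) = A x - A y"
    "A 0 = 0" "norm (A x) \<le> onorm A * norm x" "0 \<le> onorm A"
  using assms linear_simps[of A] onorm[of A] onorm_pos_le[of A] by (auto simp: bounded_op_def)

lemma bounded_op_intro:
  assumes "\<And>x y. A (x + y) = A x + A y" "\<And>c x. A (c *\<^sub>C x) = c *\<^sub>C A x"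
    "\<And>x. norm (A x) \<le> C * norm x"
  shows "bounded_op A"
  unfolding bounded_op_def
proof (intro conjI allI)
  show "bounded_linear A"
    by (rule bounded_linear_intro[where K = C])
       (use assms assms(2)[of "of_real r" for r] in \<open>auto simp: mult.commute scaleC_of_real\<close>)
qed (rule assms)

lemma bounded_op_ident [simp, intro]: "bounded_op (\<lambda>x. x)"
  by (rule bounded_op_intro[where C = 1]) auto

lemma bounded_op_zero [simp, intro]: "bounded_op (\<lambda>x. 0)"
  by (rule bounded_op_intro[where C = 0]) auto

lemma bounded_op_scaleC [intro]: "bounded_op A \<Longrightarrow> bounded_op (\<lambda>x. c *\<^sub>C A x)"
  using bounded_linear_compose[OF bounded_linear_scaleC]
  by (auto simp: bounded_op_def mult.commute)

lemma bounded_op_add [intro]: "bounded_op A \<Longrightarrow> bounded_op B \<Longrightarrow> bounded_op (\<lambda>x. A x + B x)"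
  by (auto simp: bounded_op_def bounded_linear_add scaleC_distribs)

lemma bounded_op_diff [intro]: "bounded_op A \<Longrightarrow> bounded_op B \<Longrightarrow> bounded_op (\<lambda>x. A x - B x)"
  by (auto simp: bounded_op_def bounded_linear_sub scaleC_distribs)

lemma bounded_op_compose: "bounded_op A \<Longrightarrow> bounded_op B \<Longrightarrow> bounded_op (\<lambda>x. A (B x))"
  by (auto simp: bounded_op_def bounded_linear_compose)

text \<open>Identities between limits are proved by bounding their difference by a multiple of the
  approximation error \<open>e\<close>. Callers may use \<open>e < 1\<close>, which keeps bounds on
  the approximants independent of \<open>e\<close>.\<close>

lemma zero_if_small:
  fixes u :: "'a :: real_normed_vector"
  assumes "\<And>e. 0 < e \<Longrightarrow> e < 1 \<Longrightarrow> norm u \<le> e * C"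
  shows "u = 0"
proof (rule ccontr)
  assume u: "u \<noteq> 0"
  define k where "k = \<bar>C\<bar> + 1"
  define e where "e = min (1 / 2) (norm u / (2 * k))"
  have k: "k > 0" "C \<le> k" by (auto simp: k_def)
  have e: "0 < e" "e < 1" using u k by (auto simp: e_def min_def)
  have "norm u \<le> e * C" by (rule assms[OF e])
  also have "\<dots> \<le> e * k" using e k by (intro mult_left_mono) auto
  also have "\<dots> \<le> norm u / (2 * k) * k" using k by (intro mult_right_mono) (auto simp: e_def)
  also have "\<dots> = norm u / 2" using k by simp
  finally show False using u by simp
qed

text \<open>Here \<open>B\<close> is an arbitrary function: additivity, homogeneity and boundedness
  are all inherited from the approximants.\<close>

lemma bounded_op_limit:
  assumes B: "\<And>e. e > 0 \<Longrightarrow> \<exists>A. bounded_op A \<and> (\<forall>x. norm (A x - B x) \<le> e * norm x)"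
  shows "bounded_op B"
proof -
  have add: "B (x + y) = B x + B y" for x y
  proof -
    have "B (x + y) - (B x + B y) = 0"
    proof (rule zero_if_small)
      fix e :: real assume "e > 0"
      obtain A where A: "bounded_op A" "\<And>x. norm (A x - B x) \<le> e * norm x"
        using B[OF \<open>e > 0\<close>] by blast
      have "B (x + y) - (B x + B y) = (A x - B x) + (A y - B y) - (A (x + y) - B (x + y))"
        by (simp add: bounded_opD[OF A(1)])
      also have "norm \<dots> \<le> norm (A x - B x) + norm (A y - B y) + norm (A (x + y) - B (x + y))"
        by (intro order_trans[OF norm_triangle_ineq4] add_right_mono norm_triangle_ineq)
      finally show "norm (B (x + y) - (B x + B y)) \<le> e * (norm (x + y) + norm x + norm y)"
        using A(2)[of x] A(2)[of y] A(2)[of "x + y"] by (simp add: algebra_simps)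
    qed
    then show ?thesis by simp
  qed
  have scale: "B (c *\<^sub>C x) = c *\<^sub>C B x" for c x
  proof -
    have "B (c *\<^sub>C x) - c *\<^sub>C B x = 0"
    proof (rule zero_if_small)
      fix e :: real assume "e > 0"
      obtain A where A: "bounded_op A" "\<And>x. norm (A x - B x) \<le> e * norm x"
        using B[OF \<open>e > 0\<close>] by blast
      have "B (c *\<^sub>C x) - c *\<^sub>C B x = c *\<^sub>C (A x - B x) - (A (c *\<^sub>C x) - B (c *\<^sub>C x))"
        by (simp add: bounded_opD[OF A(1)] scaleC_distribs)
      also have "norm \<dots> \<le> cmod c * norm (A x - B x) + norm (A (c *\<^sub>C x) - B (c *\<^sub>C x))"
        by (metis norm_scaleC norm_triangle_ineq4)
      finally show "norm (B (c *\<^sub>C x) - c *\<^sub>C B x) \<le> e * (2 * cmod c * norm x)"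
        using mult_left_mono[OF A(2)[of x] norm_ge_zero[of c]] A(2)[of "c *\<^sub>C x"]
        by (simp add: norm_scaleC algebra_simps)
    qed
    then show ?thesis by simp
  qed
  obtain A where A: "bounded_op A" "\<And>x. norm (A x - B x) \<le> 1 * norm x"
    using B[of 1] by auto
  have "norm (B x) \<le> (onorm A + 1) * norm x" for x
    using norm_triangle_ineq4[of "A x" "A x - B x"] A(2)[of x] bounded_opD(6)[OF A(1), of x]
    by (simp add: algebra_simps)
  then show ?thesis using add scale by (blast intro: bounded_op_intro)
qed

lemma norm_diff_sq:
  fixes x y :: "'a :: real_inner"
  shows "(norm (x - y))\<^sup>2 = (norm x)\<^sup>2 - 2 * inner x y + (norm y)\<^sup>2"
  by (simp add: power2_norm_eq_inner inner_diff_left inner_diff_right inner_commute[of y x])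

lemma onorm_le_nonneg: "(\<And>x. norm (A x) \<le> b * norm x) \<Longrightarrow> 0 \<le> b \<Longrightarrow> onorm A \<le> b"
  by (rule onorm_bound)

text \<open>The real inner product determines the complex one, since
  \<open>Im w = Re (- \<i> * w)\<close> and \<open>A\<close> commutes with multiplication by
  \<open>\<i>\<close>.\<close>

lemma self_adjoint_iff:
  "self_adjoint A \<longleftrightarrow> bounded_op A \<and> (\<forall>x y. inner (A x) y = inner x (A y))"
proof (intro iffI conjI allI)
  assume "self_adjoint A"
  then show "bounded_op A" "\<And>x y. inner (A x) y = inner x (A y)"
    by (auto simp: self_adjoint_def inner_ell2_eq_Re_cinner)
next
  assume *: "bounded_op A \<and> (\<forall>x y. inner (A x) y = inner x (A y))"
  have "cinner_ell2 (A x) y = cinner_ell2 x (A y)" for x y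
    using * by (metis bounded_opD(2) cinner_conv_inner)
  then show "self_adjoint A" using * by (simp add: self_adjoint_def)
qed

lemma self_adjointD:
  assumes "self_adjoint A"
  shows "bounded_op A" "inner (A x) y = inner x (A y)"
  using assms by (auto simp: self_adjoint_iff)


section \<open>Invertibility\<close>

lemma invertible_opI:
  assumes "bounded_op A" "bounded_op B" "\<And>x. B (A x) = x" "\<And>x. A (B x) = x"
  shows "invertible_op A"
  using assms unfolding invertible_op_def by (auto simp: fun_eq_iff)

lemma invertible_opE:
  assumes "invertible_op A"
  obtains B where "bounded_op B" "\<And>x. B (A x) = x" "\<And>x. A (B x) = x"
  using assms unfolding invertible_op_def by (auto simp: fun_eq_iff)

lemma invertible_op_compose:
  assumes "invertible_op A" "invertible_op B"
  shows "invertible_op (\<lambda>x. A (B x))"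
proof -
  obtain A' where "bounded_op A'" "\<And>x. A' (A x) = x" "\<And>x. A (A' x) = x"
    using assms(1) by (rule invertible_opE) (rule that, simp_all)
  moreover obtain B' where "bounded_op B'" "\<And>x. B' (B x) = x" "\<And>x. B (B' x) = x"
    using assms(2) by (rule invertible_opE) (rule that, simp_all)
  moreover have "bounded_op A" "bounded_op B" using assms by (auto simp: invertible_op_def)
  ultimately show ?thesis
    by (intro invertible_opI[where B = "\<lambda>x. B' (A' x)"]) (simp_all add: bounded_op_compose)
qed

lemma invertible_op_scaleC: "c \<noteq> 0 \<Longrightarrow> invertible_op (\<lambda>x. c *\<^sub>C x)"
  by (rule invertible_opI[where B = "\<lambda>x. (1 / c) *\<^sub>C x"]) auto

lemma invertible_op_bounded_below:
  assumes "invertible_op A"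
  obtains D where "D > 0" "\<And>x. norm x \<le> D * norm (A x)"
proof -
  obtain B where B: "bounded_op B" "\<And>x. B (A x) = x" using assms
    by (rule invertible_opE) (rule that, simp_all)
  have "norm x \<le> (onorm B + 1) * norm (A x)" for x
    using bounded_opD(6)[OF B(1), of "A x"] norm_ge_zero[of "A x"]
      unfolding B(2) distrib_right by linarith
  then show ?thesis using bounded_opD(7)[OF B(1)] by (intro that[of "onorm B + 1"]) auto
qed

text \<open>For coercive \<open>A\<close> and small \<open>t\<close>, the map \<open>x \<mapsto> x - t (A x - y)\<close> is a contraction, and its fixed
  point solves \<open>A x = y\<close>.\<close>

lemma coercive_imp_invertible:
  assumes A: "bounded_op A" and c: "c > 0" and coercive: "\<And>x. c * (norm x)\<^sup>2 \<le> inner (A x) x"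
  shows "invertible_op A"
proof -
  \<comment> \<open>Adding \<open>c\<close> makes \<open>M\<close> positive and ensures
    \<open>c \<le> M\<close>, so that the radicand of \<open>q\<close> is nonnegative.\<close>
  define M where "M = onorm A + c"
  have M: "M > 0" "c \<le> M" "\<And>x. norm (A x) \<le> M * norm x"
  proof -
    fix x show "norm (A x) \<le> M * norm x"
      using bounded_opD(6)[OF A, of x] mult_nonneg_nonneg[OF less_imp_le[OF c] norm_ge_zero[of x]]
      by (simp add: M_def algebra_simps)
  qed (use bounded_opD(7)[OF A] c in \<open>auto simp: M_def\<close>)
  \<comment> \<open>This value minimizes \<open>1 - 2 * t * c + t\<^sup>2 * M\<^sup>2\<close>, the
    factor in the estimate of the squared norm of \<open>x - t *\<^sub>R A x\<close>; the minimum is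
    \<open>q\<^sup>2\<close>.\<close>
  define t where "t = c / M\<^sup>2"
  define q where "q = sqrt (1 - c\<^sup>2 / M\<^sup>2)"
  have t: "t > 0" using c M by (simp add: t_def)
  have frac: "c\<^sup>2 / M\<^sup>2 \<le> 1" "c\<^sup>2 / M\<^sup>2 > 0" using c M by (auto intro!: power_mono)
  then have q: "0 \<le> q" "q < 1" by (auto simp: q_def)
  have contract: "norm (x - t *\<^sub>R A x) \<le> q * norm x" for x
  proof -
    have "(norm (x - t *\<^sub>R A x))\<^sup>2 = (norm x)\<^sup>2 - 2 * t * inner (A x) x + t\<^sup>2 * (norm (A x))\<^sup>2"
      unfolding norm_diff_sq by (simp add: inner_commute[of x "A x"] power_mult_distrib)
    also have "\<dots> \<le> (norm x)\<^sup>2 - 2 * t * (c * (norm x)\<^sup>2) + t\<^sup>2 * (M * norm x)\<^sup>2"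
      using t coercive[of x] M(3)[of x]
      by (intro add_mono diff_mono mult_left_mono power_mono) auto
    also have "\<dots> = (1 - c\<^sup>2 / M\<^sup>2) * (norm x)\<^sup>2"
      using M(1) by (simp add: t_def field_simps power2_eq_square)
    also have "\<dots> = (q * norm x)\<^sup>2"
      using frac by (simp add: q_def power_mult_distrib)
    finally show ?thesis by (rule power2_le_imp_le) (use q in auto)
  qed
  have ex1: "\<exists>!x. A x = y" for y
  proof -
    have "\<exists>!x. x - t *\<^sub>R (A x - y) = x"
    proof (rule banach_fix_type[OF q], intro allI)
      fix x z
      have "(x - t *\<^sub>R (A x - y)) - (z - t *\<^sub>R (A z - y)) = (x - z) - t *\<^sub>R A (x - z)"
        by (simp add: bounded_opD[OF A] scaleR_diff_right)
      then show "dist (x - t *\<^sub>R (A x - y)) (z - t *\<^sub>R (A z - y)) \<le> q * dist x z"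
        using contract[of "x - z"] by (simp only: dist_norm)
    qed
    then show ?thesis using t by simp
  qed
  define B where "B y = (THE x. A x = y)" for y
  have AB: "A (B y) = y" for y unfolding B_def using theI'[OF ex1] .
  have BA: "B (A x) = x" for x using ex1 AB by metis
  have "bounded_op B"
  proof (rule bounded_op_intro[where C = "1 / c"])
    show "B (x + y) = B x + B y" for x y by (metis AB BA bounded_opD(3)[OF A])
    show "B (k *\<^sub>C x) = k *\<^sub>C B x" for k x by (metis AB BA bounded_opD(2)[OF A])
    fix x
    have "c * (norm (B x))\<^sup>2 \<le> norm x * norm (B x)"
      using coercive[of "B x"] norm_cauchy_schwarz[of x "B x"] AB by simp
    then have "c * norm (B x) \<le> norm x"
      by (cases "B x = 0") (auto simp: power2_eq_square)
    then show "norm (B x) \<le> 1 / c * norm x" using c by (simp add: field_simps)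
  qed
  then show ?thesis using A AB BA by (intro invertible_opI[of A B])
qed

section \<open>Spectrum and numerical range of a self-adjoint operator\<close>

lemma inner_self_adjoint_i:
  assumes "self_adjoint A" shows "inner (\<i> *\<^sub>C A x) x = 0"
proof -
  have "inner (\<i> *\<^sub>C A x) x = inner (A x) ((- \<i>) *\<^sub>C x)" by (simp add: inner_scaleC_left)
  also have "\<dots> = inner x ((- \<i>) *\<^sub>C A x)"
    using assms by (simp add: self_adjointD bounded_opD[OF self_adjointD(1)[OF assms]])
  also have "\<dots> = - inner (\<i> *\<^sub>C A x) x"
    by (simp add: scaleC_minus inner_commute)
  finally show ?thesis by simp
qed

lemma inner_i_self: "inner (\<i> *\<^sub>C x) x = 0"
  using inner_self_adjoint_i[of "\<lambda>x. x"] by (simp add: self_adjoint_iff)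

text \<open>For \<open>z\<close> off the segment a unimodular \<open>u\<close> makes
  \<open>u (A - z)\<close> coercive: \<open>\<i>\<close> or \<open>- \<i>\<close> if
  \<open>Im z \<noteq> 0\<close>, \<open>1\<close> to the left of \<open>m\<close>,
  \<open>- 1\<close> to the right of \<open>M\<close>. In the first two cases the form of
  \<open>A\<close>, being real, drops out.\<close>

lemma spectrum_subset_numerical_range:
  assumes A: "self_adjoint A"
    and range: "\<And>x. m * (norm x)\<^sup>2 \<le> inner (A x) x" "\<And>x. inner (A x) x \<le> M * (norm x)\<^sup>2"
  shows "spectrum A \<subseteq> complex_of_real ` {m..M}"
proof
  fix z assume z: "z \<in> spectrum A"
  have bA: "bounded_op A" using A by (rule self_adjointD)
  have coercive: False if "c > 0" "u \<noteq> 0" "\<And>x. c * (norm x)\<^sup>2 \<le> inner (u *\<^sub>C (A x - z *\<^sub>C x)) x" for c u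
  proof -
    have "invertible_op (\<lambda>x. u *\<^sub>C (A x - z *\<^sub>C x))"
      by (rule coercive_imp_invertible[OF _ that(1,3)])
         (intro bounded_op_scaleC bounded_op_diff bounded_op_ident bA)
    from invertible_op_compose[OF invertible_op_scaleC[of "1 / u"] this]
    show False using that(2) z by (simp add: spectrum_def)
  qed
  have re: "inner (A x - z *\<^sub>C x) x = inner (A x) x - Re z * (norm x)\<^sup>2" for x
  proof -
    have "z *\<^sub>C x = Re z *\<^sub>R x + Im z *\<^sub>R (\<i> *\<^sub>C x)"
      by (rule ell2_eqI) (simp add: complex_eq_iff)
    then show ?thesis
      by (simp add: inner_diff_left inner_add_left inner_i_self power2_norm_eq_inner)
  qed
  have im: "inner (\<i> *\<^sub>C (A x - z *\<^sub>C x)) x = Im z * (norm x)\<^sup>2" for x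
  proof -
    have "\<i> *\<^sub>C z *\<^sub>C x = Re z *\<^sub>R (\<i> *\<^sub>C x) - Im z *\<^sub>R x"
      by (rule ell2_eqI) (simp add: complex_eq_iff)
    then show ?thesis
      by (simp only: scaleC_distribs inner_diff_left inner_add_left inner_scaleR_left inner_i_self
          inner_self_adjoint_i[OF A] power2_norm_eq_inner)
  qed
  have minus: "inner ((- u) *\<^sub>C y) x = - inner (u *\<^sub>C y) x" for u x y
    by (simp add: scaleC_minus)
  have "Im z = 0"
  proof (rule ccontr)
    assume "Im z \<noteq> 0"
    then consider "Im z > 0" | "- Im z > 0" by linarith
    then show False
    proof cases
      case 1 then show False using coercive[of "Im z" \<i>] im by simp
    next
      case 2 then show False using coercive[of "- Im z" "- \<i>"] im by (simp add: minus)
    qed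
  qed
  moreover have "m \<le> Re z"
  proof (rule ccontr)
    assume "\<not> m \<le> Re z"
    then show False using coercive[of "m - Re z" 1] range(1) by (simp add: re left_diff_distrib)
  qed
  moreover have "Re z \<le> M"
  proof (rule ccontr)
    assume "\<not> Re z \<le> M"
    then show False using coercive[of "Re z - M" "- 1"] range(2)
      by (simp add: minus re left_diff_distrib)
  qed
  ultimately show "z \<in> complex_of_real ` {m..M}"
    by (intro image_eqI[of _ _ "Re z"]) (auto simp: complex_eq_iff)
qed

lemma self_adjoint_spectrum_real:
  assumes A: "self_adjoint A" and "z \<in> spectrum A"
  shows "z \<in> \<real>"
proof -
  have "\<bar>inner (A x) x\<bar> \<le> onorm A * (norm x)\<^sup>2" for x
    using Cauchy_Schwarz_ineq2[of "A x" x] bounded_opD(6)[OF self_adjointD(1)[OF A], of x]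
      mult_right_mono[of "norm (A x)" "onorm A * norm x" "norm x"]
    by (simp add: power2_eq_square mult.assoc)
  then have "- onorm A * (norm x)\<^sup>2 \<le> inner (A x) x" "inner (A x) x \<le> onorm A * (norm x)\<^sup>2" for x
    by (simp_all add: abs_le_iff minus_le_iff)
  then show ?thesis using spectrum_subset_numerical_range[OF A] assms(2) by fastforce
qed

section \<open>Polynomials of an operator\<close>

lemma poly_op_extend:
  assumes "degree p \<le> n"
  shows "poly_op p A x = (\<Sum>i\<le>n. coeff p i *\<^sub>C (A ^^ i) x)"
  unfolding poly_op_def
  by (rule sum.mono_neutral_left) (use assms in \<open>auto simp: coeff_eq_0\<close>)

lemma poly_op_0 [simp]: "poly_op 0 A x = 0"
  by (simp add: poly_op_def)

text \<open>The Horner step for the inductions on polynomials below.\<close>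

lemma poly_op_pCons:
  assumes "bounded_op A"
  shows "poly_op (pCons c p) A x = c *\<^sub>C x + A (poly_op p A x)"
proof -
  interpret bounded_linear A using assms by (rule bounded_opD)
  have "poly_op (pCons c p) A x = (\<Sum>i\<le>Suc (degree p). coeff (pCons c p) i *\<^sub>C (A ^^ i) x)"
    by (rule poly_op_extend) (rule degree_pCons_le)
  also have "\<dots> = c *\<^sub>C x + (\<Sum>i\<le>degree p. coeff p i *\<^sub>C A ((A ^^ i) x))"
    by (simp only: sum.atMost_Suc_shift coeff_pCons_0 coeff_pCons_Suc funpow.simps o_apply id_apply)
  also have "(\<Sum>i\<le>degree p. coeff p i *\<^sub>C A ((A ^^ i) x)) = A (poly_op p A x)"
    by (simp add: poly_op_def sum bounded_opD(2)[OF assms])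
  finally show ?thesis .
qed

lemma bounded_op_poly_op [intro]:
  assumes "bounded_op A" shows "bounded_op (poly_op p A)"
proof (induction p)
  case 0
  have "poly_op 0 A = (\<lambda>x. 0)" by (simp add: fun_eq_iff)
  then show ?case by simp
next
  case (pCons c p)
  have "poly_op (pCons c p) A = (\<lambda>x. c *\<^sub>C x + A (poly_op p A x))"
    by (simp add: fun_eq_iff poly_op_pCons[OF assms])
  moreover have "bounded_op (\<lambda>x. c *\<^sub>C x + A (poly_op p A x))"
    by (intro bounded_op_add bounded_op_scaleC bounded_op_ident bounded_op_compose[OF assms] pCons.IH)
  ultimately show ?case by simp
qed

lemma poly_op_add:
  assumes "bounded_op A" shows "poly_op (p + q) A x = poly_op p A x + poly_op q A x"
  by (induction p q rule: poly_induct2)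
     (simp_all add: poly_op_pCons[OF assms] scaleC_distribs bounded_opD[OF assms])

lemma poly_op_smult:
  assumes "bounded_op A" shows "poly_op (smult c p) A x = c *\<^sub>C poly_op p A x"
  by (induction p)
     (simp_all add: poly_op_pCons[OF assms] scaleC_distribs bounded_opD[OF assms])

lemma poly_op_diff:
  assumes "bounded_op A" shows "poly_op (p - q) A x = poly_op p A x - poly_op q A x"
  using poly_op_add[OF assms, of "p - q" q x] by simp

lemma poly_op_mult:
  assumes "bounded_op A" shows "poly_op (p * q) A x = poly_op p A (poly_op q A x)"
  by (induction p)
     (simp_all add: poly_op_pCons[OF assms] poly_op_add[OF assms] poly_op_smult[OF assms])

lemma poly_op_adjoint:
  assumes "self_adjoint A"
  shows "inner (poly_op p A x) y = inner x (poly_op (map_poly cnj p) A y)"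
proof (induction p arbitrary: x y)
  case (pCons c p)
  have bA: "bounded_op A" using assms by (rule self_adjointD)
  have comm: "A (poly_op q A z) = poly_op q A (A z)" for q z
    by (induction q) (simp_all add: poly_op_pCons[OF bA] bounded_opD[OF bA])
  show ?case
    by (simp add: poly_op_pCons[OF bA] map_poly_pCons inner_add_left inner_add_right
        inner_scaleC_left self_adjointD(2)[OF assms] pCons comm)
qed simp

lemma poly_map_cnj_real:
  assumes "z \<in> \<real>" shows "poly (map_poly cnj p) z = cnj (poly p z)"
  using assms by (induction p) (auto simp: map_poly_pCons Reals_cnj_iff)

text \<open>Each root \<open>r\<close> of \<open>q\<close> lies outside the spectrum, so the factor
  \<open>A - r\<close> is invertible and can be split off. Applied to \<open>q - [:z:]\<close>, this
  places the spectral values of \<open>q(A)\<close> among the values of \<open>q\<close> on the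
  spectrum of \<open>A\<close>.\<close>

lemma poly_op_invertible:
  assumes A: "bounded_op A"
  shows "q \<noteq> 0 \<Longrightarrow> (\<And>z. z \<in> spectrum A \<Longrightarrow> poly q z \<noteq> 0) \<Longrightarrow> invertible_op (poly_op q A)"
proof (induction "degree q" arbitrary: q)
  case 0
  then obtain c where c: "q = [:c:]" "c \<noteq> 0" by (metis degree_eq_zeroE pCons_0_0)
  have "poly_op q A = (\<lambda>x. c *\<^sub>C x)"
    by (simp add: fun_eq_iff c poly_op_pCons[OF A] bounded_opD[OF A])
  then show ?case using invertible_op_scaleC[OF c(2)] by simp
next
  case (Suc n)
  have "\<not> constant (poly q)" using Suc.hyps(2) by (simp add: constant_degree)
  then obtain r where "poly q r = 0" using fundamental_theorem_of_algebra by blast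
  then obtain s where s: "q = [:- r, 1:] * s" using poly_eq_0_iff_dvd dvdE by metis
  have "s \<noteq> 0" using Suc.prems(1) s by auto
  then have "degree q = Suc (degree s)" unfolding s by (subst degree_mult_eq) auto
  then have "invertible_op (poly_op s A)"
    using Suc.prems s \<open>s \<noteq> 0\<close> by (intro Suc.hyps(1)) (use Suc.hyps(2) in auto)
  moreover have "r \<notin> spectrum A" using Suc.prems(2) \<open>poly q r = 0\<close> by blast
  then have "invertible_op (\<lambda>x. A x - r *\<^sub>C x)" by (simp add: spectrum_def)
  ultimately have "invertible_op (\<lambda>x. A (poly_op s A x) - r *\<^sub>C poly_op s A x)"
    using invertible_op_compose by fastforce
  moreover have "poly_op q A = (\<lambda>x. A (poly_op s A x) - r *\<^sub>C poly_op s A x)"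
    unfolding s fun_eq_iff poly_op_mult[OF A]
    by (simp add: poly_op_pCons[OF A] bounded_opD[OF A] scaleC_minus)
  ultimately show ?case by simp
qed

text \<open>If neither \<open>M = \<parallel>A\<parallel>\<close> nor \<open>-M\<close> is in the spectrum, then \<open>A\<^sup>2 - M\<^sup>2\<close> is bounded below, while
  \<open>\<parallel>A\<^sup>2 x - M\<^sup>2 x\<parallel>\<^sup>2 \<le> M\<^sup>2 (M\<^sup>2 \<parallel>x\<parallel>\<^sup>2 - \<parallel>A x\<parallel>\<^sup>2)\<close>; this improves the bound \<open>M\<close>.\<close>

lemma self_adjoint_norm_le:
  assumes A: "self_adjoint A" and r: "\<And>z. z \<in> spectrum A \<Longrightarrow> cmod z \<le> r" "0 \<le> r"
  shows "norm (A x) \<le> r * norm x"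
proof -
  have bA: "bounded_op A" using A by (rule self_adjointD)
  define M where "M = onorm A"
  have nA: "norm (A y) \<le> M * norm y" for y
    unfolding M_def by (rule bounded_opD(6)[OF bA])
  have "M \<le> r"
  proof (rule ccontr)
    assume "\<not> M \<le> r"
    then have M: "M > 0" "M > r" using r(2) by auto
    have inv: "invertible_op (\<lambda>x. A x - of_real s *\<^sub>C x)" if "\<bar>s\<bar> = M" for s
      using r(1)[of "of_real s"] M that by (auto simp: spectrum_def)
    have "invertible_op (\<lambda>x. A (A x - of_real (- M) *\<^sub>C x) - of_real M *\<^sub>C (A x - of_real (- M) *\<^sub>C x))"
      by (rule invertible_op_compose[OF inv inv]) (use M in auto)
    also have "(\<lambda>x. A (A x - of_real (- M) *\<^sub>C x) - of_real M *\<^sub>C (A x - of_real (- M) *\<^sub>C x))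
        = (\<lambda>x. A (A x) - M\<^sup>2 *\<^sub>R x)"
      by (simp add: fun_eq_iff bounded_opD[OF bA] scaleC_distribs scaleC_minus scaleC_of_real
          linear_simps[OF bounded_opD(1)[OF bA]] power2_eq_square flip: of_real_mult)
    finally obtain D where D: "D > 0" "\<And>x. norm x \<le> D * norm (A (A x) - M\<^sup>2 *\<^sub>R x)"
      by (rule invertible_op_bounded_below) blast
    \<comment> \<open>The gain over \<open>M\<^sup>2\<close>: inserting the upper estimate into the
      lower bound gives \<open>(norm x)\<^sup>2 \<le> D\<^sup>2 * M\<^sup>2 * (M\<^sup>2 * (norm
      x)\<^sup>2 - (norm (A x))\<^sup>2)\<close>.\<close>
    define k where "k = 1 / (D\<^sup>2 * M\<^sup>2)"
    have k: "k > 0" using D M by (simp add: k_def)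
    have *: "(norm (A x))\<^sup>2 \<le> (M\<^sup>2 - k) * (norm x)\<^sup>2" for x
    proof -
      have "(norm (A (A x) - M\<^sup>2 *\<^sub>R x))\<^sup>2
          = (norm (A (A x)))\<^sup>2 - 2 * M\<^sup>2 * inner (A (A x)) x + M ^ 4 * (norm x)\<^sup>2"
        unfolding norm_diff_sq by (simp add: power_mult_distrib flip: power_mult)
      also have "inner (A (A x)) x = (norm (A x))\<^sup>2"
        by (simp add: self_adjointD(2)[OF A] power2_norm_eq_inner)
      also have "(norm (A (A x)))\<^sup>2 \<le> M\<^sup>2 * (norm (A x))\<^sup>2"
        using power_mono[OF nA[of "A x"], of 2] by (simp add: power_mult_distrib)
      finally have "(norm (A (A x) - M\<^sup>2 *\<^sub>R x))\<^sup>2 \<le> M\<^sup>2 * (M\<^sup>2 * (norm x)\<^sup>2 - (norm (A x))\<^sup>2)"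
        by (simp add: algebra_simps power4_eq_xxxx power2_eq_square)
      moreover have "(norm x)\<^sup>2 \<le> D\<^sup>2 * (norm (A (A x) - M\<^sup>2 *\<^sub>R x))\<^sup>2"
        using power_mono[OF D(2)[of x], of 2] by (simp add: power_mult_distrib)
      ultimately have "(norm x)\<^sup>2 \<le> D\<^sup>2 * (M\<^sup>2 * (M\<^sup>2 * (norm x)\<^sup>2 - (norm (A x))\<^sup>2))"
        by (meson mult_left_mono order_trans zero_le_power2)
      then show ?thesis
        using D M by (simp add: k_def field_simps)
    qed
    define s where "s = sqrt (max 0 (M\<^sup>2 - k))"
    have s: "0 \<le> s" "s\<^sup>2 = max 0 (M\<^sup>2 - k)" by (auto simp: s_def)
    have "norm (A x) \<le> s * norm x" for x
    proof -
      have "(norm (A x))\<^sup>2 \<le> (s * norm x)\<^sup>2"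
        using *[of x] mult_right_mono[of "M\<^sup>2 - k" "s\<^sup>2" "(norm x)\<^sup>2"] s
        by (simp add: power_mult_distrib)
      then show ?thesis by (rule power2_le_imp_le) (use s in auto)
    qed
    then have "M \<le> s" unfolding M_def using s(1) by (rule onorm_le_nonneg)
    then have "M\<^sup>2 \<le> s\<^sup>2" using M by (simp add: power_mono)
    then show False using k M unfolding s by (simp add: max_def split: if_splits)
  qed
  then show ?thesis using nA[of x] by (meson mult_right_mono norm_ge_zero order_trans)
qed

text \<open>The C*-identity on vectors: the squared norm of \<open>p(A) x\<close> is
  \<open>inner (q(A) x) x\<close> with \<open>q\<close> the product of \<open>p\<close> and its
  conjugate. Since \<open>q(A)\<close> is self-adjoint with spectral values among the squared moduli
  of \<open>p\<close>, \<open>self_adjoint_norm_le\<close> bounds it.\<close>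

lemma poly_op_norm_le:
  assumes A: "self_adjoint A" and ne: "spectrum A \<noteq> {}"
    and p: "\<And>z. z \<in> spectrum A \<Longrightarrow> cmod (poly p z) \<le> r"
  shows "norm (poly_op p A x) \<le> r * norm x"
proof -
  have bA: "bounded_op A" using A by (rule self_adjointD)
  obtain z0 where z0: "z0 \<in> spectrum A" using ne by blast
  have r: "0 \<le> r" using p[OF z0] norm_ge_zero order_trans by blast
  define q where "q = map_poly cnj p * p"
  have q: "poly q z = of_real ((cmod (poly p z))\<^sup>2)" if "z \<in> spectrum A" for z
    unfolding q_def poly_mult poly_map_cnj_real[OF self_adjoint_spectrum_real[OF A that]]
      complex_norm_square by (rule mult.commute)
  have opq: "poly_op q A x = poly_op (map_poly cnj p) A (poly_op p A x)" for x
    by (simp add: q_def poly_op_mult[OF bA])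
  have adj: "inner (poly_op (map_poly cnj p) A x) y = inner x (poly_op p A y)" for x y
    by (metis inner_commute poly_op_adjoint[OF A])
  have sa: "self_adjoint (poly_op q A)"
    unfolding self_adjoint_iff using bA by (auto simp: opq adj simp flip: poly_op_adjoint[OF A])
  have "norm (poly_op q A x) \<le> r\<^sup>2 * norm x" for x
  proof (rule self_adjoint_norm_le[OF sa])
    fix z assume z: "z \<in> spectrum (poly_op q A)"
    show "cmod z \<le> r\<^sup>2"
    \<comment> \<open>\<open>poly_op_invertible\<close> excludes the zero polynomial. In that case
      \<open>q\<close> is the constant \<open>z\<close>, which is evaluated at the spectral point
      \<open>z0\<close>.\<close>
    proof (cases "q - [:z:] = 0")
      case True
      then have "poly q z0 = z" by simp
      then show ?thesis using q[OF z0] p[OF z0]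
        by (metis norm_of_real abs_power2 norm_ge_zero power_abs power_mono)
    next
      case False
      have "poly_op (q - [:z:]) A = (\<lambda>x. poly_op q A x - z *\<^sub>C x)"
        by (simp add: fun_eq_iff poly_op_diff[OF bA] poly_op_pCons[OF bA] bounded_opD[OF bA])
      then obtain w where w: "w \<in> spectrum A" "poly (q - [:z:]) w = 0"
        using poly_op_invertible[OF bA False] z unfolding spectrum_def by auto
      then have "z = of_real ((cmod (poly p w))\<^sup>2)" using q[OF w(1)] by simp
      then have "cmod z = (cmod (poly p w))\<^sup>2" by (simp only: norm_of_real abs_power2)
      then show ?thesis using p[OF w(1)] by (simp add: power_mono)
    qed
  qed simp
  then have "(norm (poly_op p A x))\<^sup>2 \<le> r\<^sup>2 * norm x * norm x"
    unfolding power2_norm_eq_inner poly_op_adjoint[OF A] opq[symmetric]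
    by (metis inner_commute mult_right_mono norm_cauchy_schwarz norm_ge_zero order_trans)
  then have "(norm (poly_op p A x))\<^sup>2 \<le> (r * norm x)\<^sup>2"
    by (simp add: power_mult_distrib power2_eq_square mult_ac)
  then show ?thesis by (rule power2_le_imp_le) (use r in auto)
qed

section \<open>The continuous functional calculus\<close>

lemma complex_poly_approx:
  fixes f :: "complex \<Rightarrow> complex"
  assumes S: "compact S" "S \<subseteq> \<real>" and f: "continuous_on S f" and e: "e > 0"
  obtains p where "\<And>z. z \<in> S \<Longrightarrow> cmod (poly p z - f z) \<le> e"
proof -
  define R where "R = Re ` S"
  have R: "compact R" unfolding R_def
    by (rule compact_continuous_image) (use S in \<open>auto intro: continuous_intros\<close>)
  have SR: "complex_of_real x \<in> S" if "x \<in> R" for x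
    using that S(2) by (auto simp: R_def)
  have fR: "continuous_on R (\<lambda>x. f (complex_of_real x))"
    by (rule continuous_on_compose2[OF f]) (use SR in \<open>auto intro: continuous_intros\<close>)
  have approx: "\<exists>p. \<forall>x\<in>R. cmod (poly p (of_real x) - of_real (g x)) \<le> e / 2"
    if "continuous_on R g" for g :: "real \<Rightarrow> real"
  proof -
    obtain h where h: "real_polynomial_function h" "\<And>x. x \<in> R \<Longrightarrow> \<bar>g x - h x\<bar> < e / 2"
      using Stone_Weierstrass_real_polynomial_function[OF R \<open>continuous_on R g\<close>, of "e / 2"] e by auto
    then obtain a n where a: "h = (\<lambda>x. \<Sum>i\<le>n. a i * x ^ i)"
      unfolding real_polynomial_function_iff_sum by blast
    define p where "p = (\<Sum>i\<le>n. monom (complex_of_real (a i)) i)"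
    have "poly p (of_real x) = of_real (h x)" for x
      by (simp add: p_def a poly_sum poly_monom)
    moreover have "cmod (of_real (h x) - of_real (g x)) = \<bar>g x - h x\<bar>" for x
      by (simp only: norm_of_real abs_minus_commute flip: of_real_diff)
    ultimately show ?thesis using h(2) by (intro exI[of _ p]) (auto intro: less_imp_le)
  qed
  obtain p where p: "\<And>x. x \<in> R \<Longrightarrow> cmod (poly p (of_real x) - of_real (Re (f (of_real x)))) \<le> e / 2"
    using approx[OF continuous_on_Re[OF fR]] by blast
  obtain q where q: "\<And>x. x \<in> R \<Longrightarrow> cmod (poly q (of_real x) - of_real (Im (f (of_real x)))) \<le> e / 2"
    using approx[OF continuous_on_Im[OF fR]] by blast
  show ?thesis
  proof (rule that[of "p + smult \<i> q"])
    fix z assume z: "z \<in> S"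
    then have x: "Re z \<in> R" "z = of_real (Re z)" using S(2) by (auto simp: R_def)
    define u where "u = poly p z - of_real (Re (f z))"
    define v where "v = poly q z - of_real (Im (f z))"
    have "cmod u \<le> e / 2" "cmod v \<le> e / 2" using p[OF x(1)] q[OF x(1)]
      by (simp_all add: u_def v_def flip: x(2))
    moreover have "poly (p + smult \<i> q) z - f z = u + \<i> * v"
      using complex_eq[of "f z"] by (simp add: u_def v_def algebra_simps)
    ultimately show "cmod (poly (p + smult \<i> q) z - f z) \<le> e"
      using norm_triangle_ineq[of u "\<i> * v"] by (simp add: norm_mult)
  qed
qed

text \<open>The predicate under \<open>THE\<close> in \<open>cont_fun_calc\<close>, named so that
  existence and uniqueness can be stated.\<close>

definition calc_limit :: "(complex \<Rightarrow> complex) \<Rightarrow> (ell2 \<Rightarrow> ell2) \<Rightarrow> (ell2 \<Rightarrow> ell2) \<Rightarrow> bool"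
  where "calc_limit f A B \<longleftrightarrow> bounded_op B \<and>
    (\<exists>p :: nat \<Rightarrow> complex poly.
      uniform_limit (spectrum A) (\<lambda>n. poly (p n)) f sequentially \<and>
      (\<lambda>n. onorm (\<lambda>x. poly_op (p n) A x - B x)) \<longlonglongrightarrow> 0)"

text \<open>Nonemptiness and compactness of the spectrum hold for all self-adjoint operators on this
  space. Here they are assumptions; for Toeplitz operators they are read off from the range of the
  symbol.\<close>

context
  fixes A :: "ell2 \<Rightarrow> ell2"
  assumes A: "self_adjoint A" and nonempty: "spectrum A \<noteq> {}" and compact: "compact (spectrum A)"
begin

private lemma bA: "bounded_op A"
  using A by (rule self_adjointD)

private lemma spectrum_real: "spectrum A \<subseteq> \<real>"
  using self_adjoint_spectrum_real[OF A] by blast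

text \<open>Replaces the sequence and \<open>onorm\<close> by one polynomial and one pointwise
  estimate for each \<open>e\<close>. The sequence comes back with
  \<open>e = 1 / real (Suc n)\<close>.\<close>

lemma calc_limitI:
  assumes "\<And>e. e > 0 \<Longrightarrow> \<exists>p. (\<forall>z\<in>spectrum A. cmod (poly p z - f z) \<le> e) \<and>
    (\<forall>x. norm (poly_op p A x - B x) \<le> e * norm x)"
  shows "calc_limit f A B"
proof -
  have "\<forall>n. \<exists>p. (\<forall>z\<in>spectrum A. cmod (poly p z - f z) \<le> 1 / real (Suc n)) \<and>
    (\<forall>x. norm (poly_op p A x - B x) \<le> 1 / real (Suc n) * norm x)"
    by (intro allI assms) simp
  then obtain p where p: "\<And>n z. z \<in> spectrum A \<Longrightarrow> cmod (poly (p n) z - f z) \<le> 1 / real (Suc n)"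
    "\<And>n x. norm (poly_op (p n) A x - B x) \<le> 1 / real (Suc n) * norm x"
    by metis
  have lim: "(\<lambda>n. 1 / real (Suc n)) \<longlonglongrightarrow> 0"
    using LIMSEQ_inverse_real_of_nat by (simp add: inverse_eq_divide)
  have B: "bounded_op B"
  proof (rule bounded_op_limit)
    fix e :: real assume "e > 0"
    then obtain q where "\<forall>x. norm (poly_op q A x - B x) \<le> e * norm x"
      using assms[OF \<open>e > 0\<close>] by blast
    with bounded_op_poly_op[OF bA]
    show "\<exists>C. bounded_op C \<and> (\<forall>x. norm (C x - B x) \<le> e * norm x)" by (intro exI conjI)
  qed
  have "uniform_limit (spectrum A) (\<lambda>n. poly (p n)) f sequentially"
  proof (rule uniform_limitI)
    fix e :: real assume "e > 0"
    then have "\<forall>\<^sub>F n in sequentially. 1 / real (Suc n) < e" by (rule order_tendstoD[OF lim])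
    then show "\<forall>\<^sub>F n in sequentially. \<forall>z\<in>spectrum A. dist (poly (p n) z) (f z) < e"
      by eventually_elim (use p(1) in \<open>auto simp: dist_norm intro: le_less_trans\<close>)
  qed
  moreover have "(\<lambda>n. onorm (\<lambda>x. poly_op (p n) A x - B x)) \<longlonglongrightarrow> 0"
  proof (rule tendsto_sandwich[OF _ _ tendsto_const lim])
    show "\<forall>\<^sub>F n in sequentially. 0 \<le> onorm (\<lambda>x. poly_op (p n) A x - B x)"
      using bounded_opD(7)[OF bounded_op_diff[OF bounded_op_poly_op[OF bA] B]] by simp
    show "\<forall>\<^sub>F n in sequentially. onorm (\<lambda>x. poly_op (p n) A x - B x) \<le> 1 / real (Suc n)"
      by (intro always_eventually allI onorm_le_nonneg p(2)) simp
  qed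
  ultimately show ?thesis using B unfolding calc_limit_def by blast
qed

lemma calc_limitE:
  assumes "calc_limit f A B" "e > 0"
  obtains p where "\<And>z. z \<in> spectrum A \<Longrightarrow> cmod (poly p z - f z) \<le> e"
    "\<And>x. norm (poly_op p A x - B x) \<le> e * norm x"
proof -
  obtain p where B: "bounded_op B"
    and p: "uniform_limit (spectrum A) (\<lambda>n. poly (p n)) f sequentially"
    "(\<lambda>n. onorm (\<lambda>x. poly_op (p n) A x - B x)) \<longlonglongrightarrow> 0"
    using assms(1) unfolding calc_limit_def by blast
  have "\<forall>\<^sub>F n in sequentially. (\<forall>z\<in>spectrum A. dist (poly (p n) z) (f z) < e) \<and>
      onorm (\<lambda>x. poly_op (p n) A x - B x) < e"
    by (intro eventually_conj uniform_limitD[OF p(1)] order_tendstoD(2)[OF p(2)] assms(2))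
  then obtain n where n: "\<And>z. z \<in> spectrum A \<Longrightarrow> dist (poly (p n) z) (f z) < e"
    "onorm (\<lambda>x. poly_op (p n) A x - B x) < e"
    using eventually_happens by force
  have "norm (poly_op (p n) A x - B x) \<le> e * norm x" for x
    using bounded_opD(6)[OF bounded_op_diff[OF bounded_op_poly_op[OF bA] B], of "p n" x]
      mult_right_mono[OF less_imp_le[OF n(2)] norm_ge_zero[of x]] by (rule order_trans)
  then show ?thesis using n(1) by (intro that[of "p n"]) (auto simp: dist_norm intro: less_imp_le)
qed

text \<open>Compare \<open>q\<close> with a polynomial \<open>p\<close> that approximates both
  \<open>f\<close> and \<open>B\<close> within \<open>c\<close>: \<open>poly_op_norm_le\<close>
  applies to \<open>q - p\<close>, and \<open>c\<close> is arbitrarily small. This frees all later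
  proofs from the sequence in the definition.\<close>

lemma calc_limit_bound:
  assumes B: "calc_limit f A B" and q: "\<And>z. z \<in> spectrum A \<Longrightarrow> cmod (poly q z - f z) \<le> e"
  shows "norm (poly_op q A x - B x) \<le> e * norm x"
proof (rule field_le_epsilon)
  fix d :: real assume d: "d > 0"
  \<comment> \<open>Chosen for \<open>2 * c * norm x \<le> d\<close>; the summand 1 covers
    \<open>x = 0\<close>.\<close>
  define c where "c = d / (2 * (norm x + 1))"
  have nx: "norm x + 1 > 0" using norm_ge_zero[of x] by linarith
  then have c: "c > 0" using d by (simp add: c_def)
  obtain p where p: "\<And>z. z \<in> spectrum A \<Longrightarrow> cmod (poly p z - f z) \<le> c"
    "\<And>x. norm (poly_op p A x - B x) \<le> c * norm x"
    using calc_limitE[OF B c] by blast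
  have "cmod (poly (q - p) z) \<le> e + c" if "z \<in> spectrum A" for z
    using norm_triangle_ineq4[of "poly q z - f z" "poly p z - f z"] p(1)[OF that] q[OF that] by simp
  then have "norm (poly_op (q - p) A x) \<le> (e + c) * norm x"
    by (rule poly_op_norm_le[OF A nonempty])
  then have "norm (poly_op q A x - poly_op p A x) \<le> (e + c) * norm x"
    by (simp add: poly_op_diff[OF bA])
  then have "norm (poly_op q A x - B x) \<le> e * norm x + 2 * c * norm x"
    using norm_triangle_ineq[of "poly_op q A x - poly_op p A x" "poly_op p A x - B x"] p(2)[of x]
    by (simp add: algebra_simps)
  also have "2 * c * norm x \<le> d"
  proof -
    have "d * norm x \<le> d * (norm x + 1)" using d by simp
    then show ?thesis using nx by (simp add: c_def field_simps)
  qed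
  finally show "norm (poly_op q A x - B x) \<le> e * norm x + d" by simp
qed

lemma calc_limit_unique:
  assumes "calc_limit f A B" "calc_limit f A C"
  shows "B = C"
proof
  fix x
  have "B x - C x = 0"
  proof (rule zero_if_small)
    fix e :: real assume "e > 0"
    obtain p where p: "\<And>z. z \<in> spectrum A \<Longrightarrow> cmod (poly p z - f z) \<le> e"
      "\<And>x. norm (poly_op p A x - B x) \<le> e * norm x"
      using calc_limitE[OF assms(1) \<open>e > 0\<close>] by blast
    have "norm (poly_op p A x - C x) \<le> e * norm x"
      by (rule calc_limit_bound[OF assms(2) p(1)])
    then show "norm (B x - C x) \<le> e * (2 * norm x)"
      using p(2)[of x] norm_triangle_ineq4[of "poly_op p A x - C x" "poly_op p A x - B x"] by simp
  qed
  then show "B x = C x" by simp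
qed

lemma calc_limit_exists:
  assumes f: "continuous_on (spectrum A) f"
  shows "\<exists>B. calc_limit f A B"
proof -
  have "\<forall>n. \<exists>p. \<forall>z\<in>spectrum A. cmod (poly p z - f z) \<le> 1 / real (Suc n)"
    (is "\<forall>n. ?P n")
  proof
    fix n
    have "0 < 1 / real (Suc n)" by simp
    then show "?P n" by (rule complex_poly_approx[OF compact spectrum_real f]) blast
  qed
  then obtain p where p: "\<And>n z. z \<in> spectrum A \<Longrightarrow> cmod (poly (p n) z - f z) \<le> 1 / real (Suc n)"
    by metis
  have lim: "(\<lambda>n. 1 / real (Suc n)) \<longlonglongrightarrow> 0"
    using LIMSEQ_inverse_real_of_nat by (simp add: inverse_eq_divide)
  have diff: "norm (poly_op (p m) A x - poly_op (p n) A x)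
      \<le> (1 / real (Suc m) + 1 / real (Suc n)) * norm x" for m n x
  proof -
    have "cmod (poly (p m - p n) z) \<le> 1 / real (Suc m) + 1 / real (Suc n)"
      if "z \<in> spectrum A" for z
      using norm_triangle_ineq4[of "poly (p m) z - f z" "poly (p n) z - f z"]
        p[OF that, of m] p[OF that, of n] by simp
    from poly_op_norm_le[OF A nonempty this] show ?thesis by (simp add: poly_op_diff[OF bA])
  qed
  have "Cauchy (\<lambda>n. poly_op (p n) A x)" for x
  proof (rule CauchyI)
    fix e :: real assume e: "e > 0"
    have "(\<lambda>n. 1 / real (Suc n) * norm x) \<longlonglongrightarrow> 0" using tendsto_mult_left_zero[OF lim] .
    then have "\<forall>\<^sub>F n in sequentially. 1 / real (Suc n) * norm x < e / 2"
      by (rule order_tendstoD(2)) (use e in simp)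
    then obtain N where N: "\<And>n. n \<ge> N \<Longrightarrow> 1 / real (Suc n) * norm x < e / 2"
      unfolding eventually_sequentially by blast
    have "norm (poly_op (p m) A x - poly_op (p n) A x) < e" if "m \<ge> N" "n \<ge> N" for m n
      using diff[of m x n] N[OF that(1)] N[OF that(2)] unfolding distrib_right by linarith
    then show "\<exists>N. \<forall>m\<ge>N. \<forall>n\<ge>N. norm (poly_op (p m) A x - poly_op (p n) A x) < e" by blast
  qed
  then have "\<forall>x. \<exists>y. (\<lambda>n. poly_op (p n) A x) \<longlonglongrightarrow> y"
    using Cauchy_convergent convergent_def by blast
  then obtain B where B: "\<And>x. (\<lambda>n. poly_op (p n) A x) \<longlonglongrightarrow> B x" by metis
  \<comment> \<open>Letting \<open>n\<close> tend to infinity in \<open>diff\<close> gives a rate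
    proportional to \<open>norm x\<close>, hence convergence in operator norm and not only at each
    \<open>x\<close>.\<close>
  have pB: "norm (poly_op (p m) A x - B x) \<le> 1 / real (Suc m) * norm x" for m x
  proof (rule LIMSEQ_le[of "\<lambda>n. norm (poly_op (p m) A x - poly_op (p n) A x)"])
    show "(\<lambda>n. norm (poly_op (p m) A x - poly_op (p n) A x)) \<longlonglongrightarrow> norm (poly_op (p m) A x - B x)"
      by (intro tendsto_intros B)
    have "(\<lambda>n. (1 / real (Suc m) + 1 / real (Suc n)) * norm x) \<longlonglongrightarrow> (1 / real (Suc m) + 0) * norm x"
      by (intro tendsto_intros lim)
    then show "(\<lambda>n. (1 / real (Suc m) + 1 / real (Suc n)) * norm x) \<longlonglongrightarrow> 1 / real (Suc m) * norm x"
      by simp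
  qed (use diff in blast)
  have "calc_limit f A B"
  proof (rule calc_limitI)
    fix e :: real assume "e > 0"
    then have "\<forall>\<^sub>F n in sequentially. 1 / real (Suc n) < e" by (rule order_tendstoD[OF lim])
    then obtain n where n: "1 / real (Suc n) < e" using eventually_happens by force
    have "norm (poly_op (p n) A x - B x) \<le> e * norm x" for x
      using pB[of n x] mult_right_mono[OF less_imp_le[OF n] norm_ge_zero[of x]]
        by (rule order_trans)
    moreover have "cmod (poly (p n) z - f z) \<le> e" if "z \<in> spectrum A" for z
      using p[OF that, of n] n by linarith
    ultimately show "\<exists>p. (\<forall>z\<in>spectrum A. cmod (poly p z - f z) \<le> e) \<and>
        (\<forall>x. norm (poly_op p A x - B x) \<le> e * norm x)" by blast
  qed
  then show ?thesis by blast
qed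

lemma cont_fun_calc_eq:
  assumes "calc_limit f A B" shows "cont_fun_calc f A = B"
  unfolding cont_fun_calc_def calc_limit_def[symmetric]
proof (rule the_equality)
  show "calc_limit f A B" by (rule assms)
  show "C = B" if "calc_limit f A C" for C using that assms by (rule calc_limit_unique)
qed

lemma calc_limit_cont_fun_calc:
  assumes "continuous_on (spectrum A) f" shows "calc_limit f A (cont_fun_calc f A)"
  using calc_limit_exists[OF assms] cont_fun_calc_eq by metis

lemma bounded_op_cont_fun_calc:
  assumes "continuous_on (spectrum A) f" shows "bounded_op (cont_fun_calc f A)"
  using calc_limit_cont_fun_calc[OF assms] by (simp add: calc_limit_def)

lemma cont_fun_calc_poly_bound:
  assumes "continuous_on (spectrum A) f" "\<And>z. z \<in> spectrum A \<Longrightarrow> cmod (poly q z - f z) \<le> e"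
  shows "norm (poly_op q A x - cont_fun_calc f A x) \<le> e * norm x"
  by (rule calc_limit_bound[OF calc_limit_cont_fun_calc[OF assms(1)] assms(2)])

text \<open>As \<open>f\<close> and the spectrum are real, the conjugated polynomial approximates
  \<open>f\<close> equally well. So \<open>p(A)\<close> and its adjoint are both close to
  \<open>f(A)\<close>.\<close>

lemma self_adjoint_cont_fun_calc:
  assumes f: "continuous_on (spectrum A) f" and real: "\<And>z. z \<in> spectrum A \<Longrightarrow> f z \<in> \<real>"
  shows "self_adjoint (cont_fun_calc f A)"
  unfolding self_adjoint_iff
proof (intro conjI allI bounded_op_cont_fun_calc f)
  fix x y
  let ?B = "cont_fun_calc f A"
  have "inner (?B x) y - inner x (?B y) = 0"
  proof (rule zero_if_small)
    fix e :: real assume "e > 0"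
    then obtain p where p: "\<And>z. z \<in> spectrum A \<Longrightarrow> cmod (poly p z - f z) \<le> e"
      using complex_poly_approx[OF compact spectrum_real f] by blast
    define q where "q = map_poly cnj p"
    have q: "cmod (poly q z - f z) \<le> e" if "z \<in> spectrum A" for z
    proof -
      have "poly q z - f z = cnj (poly p z - f z)"
        using that real spectrum_real by (auto simp: q_def poly_map_cnj_real Reals_cnj_iff)
      then show ?thesis using p[OF that] by (metis complex_mod_cnj)
    qed
    have eq: "inner (?B x) y - inner x (?B y)
        = inner x (poly_op q A y - ?B y) - inner (poly_op p A x - ?B x) y"
      unfolding q_def by (simp add: inner_diff_left inner_diff_right poly_op_adjoint[OF A])
    have "norm (inner (?B x) y - inner x (?B y)) \<le> norm x * (e * norm y) + (e * norm x) * norm y"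
    proof -
      have "\<bar>inner x (poly_op q A y - ?B y)\<bar> \<le> norm x * (e * norm y)"
        by (rule order_trans[OF Cauchy_Schwarz_ineq2])
           (intro mult_left_mono cont_fun_calc_poly_bound[OF f q] norm_ge_zero)
      moreover have "\<bar>inner (poly_op p A x - ?B x) y\<bar> \<le> (e * norm x) * norm y"
        by (rule order_trans[OF Cauchy_Schwarz_ineq2])
           (intro mult_right_mono cont_fun_calc_poly_bound[OF f p] norm_ge_zero)
      ultimately show ?thesis unfolding eq real_norm_def by linarith
    qed
    then show "norm (inner (?B x) y - inner x (?B y)) \<le> e * (2 * norm x * norm y)"
      by (simp add: algebra_simps)
  qed
  then show "inner (?B x) y = inner x (?B y)" by simp
qed

text \<open>Multiplicativity of the calculus in the case that produces inverses: if \<open>p\<close>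
  and \<open>q\<close> approximate \<open>f\<close> and \<open>g\<close>, then \<open>p * q\<close>
  is uniformly close to 1 on the spectrum.\<close>

lemma cont_fun_calc_inverse:
  assumes f: "continuous_on (spectrum A) f" and g: "continuous_on (spectrum A) g"
    and fg: "\<And>z. z \<in> spectrum A \<Longrightarrow> f z * g z = 1"
  shows "cont_fun_calc f A (cont_fun_calc g A x) = x"
proof -
  let ?B = "cont_fun_calc f A" and ?C = "cont_fun_calc g A"
  obtain F where F: "\<And>z. z \<in> spectrum A \<Longrightarrow> cmod (f z) \<le> F"
    using compact_imp_bounded[OF compact_continuous_image[OF f compact]] by (auto simp: bounded_iff)
  obtain G where G: "\<And>z. z \<in> spectrum A \<Longrightarrow> cmod (g z) \<le> G"
    using compact_imp_bounded[OF compact_continuous_image[OF g compact]] by (auto simp: bounded_iff)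
  obtain z0 where "z0 \<in> spectrum A" using nonempty by blast
  then have FG: "0 \<le> F" "0 \<le> G" using F G norm_ge_zero by (blast intro: order_trans)+
  have "?B (?C x) - x = 0"
  proof (rule zero_if_small)
    fix e :: real assume e: "e > 0" "e < 1"
    obtain p where p: "\<And>z. z \<in> spectrum A \<Longrightarrow> cmod (poly p z - f z) \<le> e"
      using complex_poly_approx[OF compact spectrum_real f e(1)] by blast
    obtain q where q: "\<And>z. z \<in> spectrum A \<Longrightarrow> cmod (poly q z - g z) \<le> e"
      using complex_poly_approx[OF compact spectrum_real g e(1)] by blast
    \<comment> \<open>The bound \<open>e < 1\<close> makes this majorant independent of
      \<open>e\<close>.\<close>
    have pF: "cmod (poly p z) \<le> F + 1" if "z \<in> spectrum A" for z
      using norm_triangle_sub[of "poly p z" "f z"] p[OF that] F[OF that] e by simp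
    have pq: "cmod (poly (p * q - 1) z) \<le> (F + 1) * e + e * G" if z: "z \<in> spectrum A" for z
    proof -
      have "poly (p * q - 1) z = poly p z * (poly q z - g z) + (poly p z - f z) * g z"
        using fg[OF z] by (simp add: algebra_simps)
      also have "cmod \<dots> \<le> (F + 1) * e + e * G"
        by (rule order_trans[OF norm_triangle_ineq], unfold norm_mult)
           (intro add_mono mult_mono pF p q G z norm_ge_zero, use FG e in auto)
      finally show ?thesis .
    qed
    have one: "poly_op (p * q - 1) A x = poly_op p A (poly_op q A x) - x"
      by (simp add: poly_op_diff[OF bA] poly_op_mult[OF bA] poly_op_pCons[OF bA] bounded_opD[OF bA] one_pCons)
    have "?B (?C x) - x = poly_op (p * q - 1) A x - poly_op p A (poly_op q A x - ?C x)
      - (poly_op p A (?C x) - ?B (?C x))"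
      by (simp add: one bounded_opD[OF bounded_op_poly_op[OF bA]])
    also have "norm \<dots> \<le> ((F + 1) * e + e * G) * norm x + (F + 1) * (e * norm x) + e * norm (?C x)"
    proof -
      have "norm (poly_op p A (poly_op q A x - ?C x)) \<le> (F + 1) * norm (poly_op q A x - ?C x)"
        by (rule poly_op_norm_le[OF A nonempty pF])
      also have "\<dots> \<le> (F + 1) * (e * norm x)"
        using FG by (intro mult_left_mono cont_fun_calc_poly_bound[OF g q]) auto
      finally have 1: "norm (poly_op p A (poly_op q A x - ?C x)) \<le> (F + 1) * (e * norm x)" .
      have 2: "norm (poly_op (p * q - 1) A x) \<le> ((F + 1) * e + e * G) * norm x"
        by (rule poly_op_norm_le[OF A nonempty pq])
      have 3: "norm (poly_op p A (?C x) - ?B (?C x)) \<le> e * norm (?C x)"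
        by (rule cont_fun_calc_poly_bound[OF f p])
      show ?thesis
        by (intro order_trans[OF norm_triangle_ineq4] add_mono 1 2 3)
    qed
    finally show "norm (?B (?C x) - x) \<le> e * ((F + 1 + G) * norm x + (F + 1) * norm x + norm (?C x))"
      by (simp add: algebra_simps)
  qed
  then show ?thesis by simp
qed

section \<open>Spectral mapping for the continuous calculus\<close>

lemma cont_fun_calc_shift:
  assumes f: "continuous_on (spectrum A) f"
  shows "cont_fun_calc (\<lambda>z. f z - c) A = (\<lambda>x. cont_fun_calc f A x - c *\<^sub>C x)"
proof (rule cont_fun_calc_eq, rule calc_limitI)
  fix e :: real assume "e > 0"
  then obtain p where p: "\<And>z. z \<in> spectrum A \<Longrightarrow> cmod (poly p z - f z) \<le> e"
    using complex_poly_approx[OF compact spectrum_real f] by blast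
  have [simp]: "poly_op (p - [:c:]) A x = poly_op p A x - c *\<^sub>C x" for x
    by (simp add: poly_op_diff[OF bA] poly_op_pCons[OF bA] bounded_opD[OF bA])
  then show "\<exists>q. (\<forall>z\<in>spectrum A. cmod (poly q z - (f z - c)) \<le> e) \<and>
      (\<forall>x. norm (poly_op q A x - (cont_fun_calc f A x - c *\<^sub>C x)) \<le> e * norm x)"
    using p cont_fun_calc_poly_bound[OF f p] by (intro exI[of _ "p - [:c:]"] conjI allI) simp_all
qed

text \<open>If \<open>f\<close> omits the value \<open>c\<close>, then \<open>1 / (f z - c)\<close>
  is continuous on the spectrum and its calculus inverts \<open>f(A) - c\<close>.\<close>

lemma spectrum_cont_fun_calc_subset:
  assumes f: "continuous_on (spectrum A) f"
  shows "spectrum (cont_fun_calc f A) \<subseteq> f ` spectrum A"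
proof
  fix c assume c: "c \<in> spectrum (cont_fun_calc f A)"
  show "c \<in> f ` spectrum A"
  proof (rule ccontr)
    assume "c \<notin> f ` spectrum A"
    then have ne: "f z - c \<noteq> 0" if "z \<in> spectrum A" for z using that by auto
    have 1: "continuous_on (spectrum A) (\<lambda>z. f z - c)" by (intro continuous_intros f)
    have 2: "continuous_on (spectrum A) (\<lambda>z. 1 / (f z - c))" using ne
      by (intro continuous_intros f) auto
    have "invertible_op (cont_fun_calc (\<lambda>z. f z - c) A)"
      by (rule invertible_opI[OF bounded_op_cont_fun_calc[OF 1] bounded_op_cont_fun_calc[OF 2]])
         (use ne in \<open>auto intro!: cont_fun_calc_inverse 1 2\<close>)
    then show False using c by (simp add: cont_fun_calc_shift[OF f] spectrum_def)
  qed
qed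

text \<open>Dividing \<open>p - [:poly p z:]\<close> by the linear factor at \<open>z\<close> shows
  that \<open>f(A) - f(z)\<close> is \<open>q(A) (A - z)\<close> up to a small error, so a lower
  bound passes to \<open>A - z\<close>. A lower bound is what \<open>symbol_bounded_below\<close>
  takes as input.\<close>

lemma bounded_below_if_not_in_spectrum_cont_fun_calc:
  assumes f: "continuous_on (spectrum A) f" and z: "z \<in> spectrum A"
    and notin: "f z \<notin> spectrum (cont_fun_calc f A)"
  obtains c where "c > 0" "\<And>x. c * norm x \<le> norm (A x - z *\<^sub>C x)"
proof -
  let ?B = "cont_fun_calc f A"
  have "invertible_op (\<lambda>x. ?B x - f z *\<^sub>C x)" using notin by (simp add: spectrum_def)
  then obtain D where D: "D > 0" "\<And>x. norm x \<le> D * norm (?B x - f z *\<^sub>C x)"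
    by (rule invertible_op_bounded_below) blast
  \<comment> \<open>The two approximation errors contribute
    \<open>2 * D * e * norm x = norm x / 2\<close>, which the left-hand side absorbs.\<close>
  define e where "e = 1 / (4 * D)"
  have e: "e > 0" using D by (simp add: e_def)
  obtain p where p: "\<And>z. z \<in> spectrum A \<Longrightarrow> cmod (poly p z - f z) \<le> e"
    using complex_poly_approx[OF compact spectrum_real f e] by blast
  obtain q where q: "p - [:poly p z:] = [:- z, 1:] * q"
    using poly_eq_0_iff_dvd[of "p - [:poly p z:]" z] by (auto elim: dvdE)
  define M where "M = onorm (poly_op q A) + 1"
  have M: "M > 0" using bounded_opD(7)[OF bounded_op_poly_op[OF bA], of q] by (simp add: M_def)
  have "norm x \<le> 2 * D * M * norm (A x - z *\<^sub>C x)" for x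
  proof -
    let ?y = "A x - z *\<^sub>C x"
    have "poly_op (p - [:poly p z:]) A x = poly_op q A (poly_op [:- z, 1:] A x)"
      unfolding q by (subst mult.commute) (rule poly_op_mult[OF bA])
    then have "poly_op p A x - poly p z *\<^sub>C x = poly_op q A ?y"
      by (simp add: poly_op_diff[OF bA] poly_op_pCons[OF bA] bounded_opD[OF bA] scaleC_minus)
    then have eq: "?B x - f z *\<^sub>C x
        = poly_op q A ?y + (poly p z - f z) *\<^sub>C x - (poly_op p A x - ?B x)"
      by (simp add: scaleC_distribs algebra_simps)
    have "norm (poly_op q A ?y) \<le> M * norm ?y"
      using bounded_opD(6)[OF bounded_op_poly_op[OF bA], of q ?y] norm_ge_zero[of ?y]
      unfolding M_def distrib_right by linarith
    moreover have "norm ((poly p z - f z) *\<^sub>C x) \<le> e * norm x"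
      unfolding norm_scaleC by (intro mult_right_mono p z) simp
    moreover have "norm (poly_op p A x - ?B x) \<le> e * norm x"
      by (rule cont_fun_calc_poly_bound[OF f p])
    ultimately have "norm (?B x - f z *\<^sub>C x) \<le> M * norm ?y + e * norm x + e * norm x"
      using norm_triangle_ineq4[of "poly_op q A ?y + (poly p z - f z) *\<^sub>C x" "poly_op p A x - ?B x"]
        norm_triangle_ineq[of "poly_op q A ?y" "(poly p z - f z) *\<^sub>C x"]
      unfolding eq by linarith
    then have "norm x \<le> D * (M * norm ?y + e * norm x + e * norm x)"
      by (rule order_trans[OF D(2) mult_left_mono[OF _ less_imp_le[OF D(1)]]])
    also have "\<dots> = D * M * norm ?y + norm x / 2"
      using D by (simp add: e_def field_simps)
    finally show ?thesis by simp
  qed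
  then show ?thesis
    using D(1) M by (intro that[of "1 / (2 * D * M)"]) (auto simp: field_simps)
qed

end

section \<open>Means and Fourier coefficients\<close>

text \<open>Normalized so that the exponentials are orthonormal; polymorphic because complex symbols
  and real squared moduli are both averaged.\<close>

definition mean :: "(real \<Rightarrow> 'a::banach) \<Rightarrow> 'a"
  where "mean g = (1 / (2 * pi)) *\<^sub>R integral {0..2*pi} g"

lemma mean_cong: "(\<And>t. t \<in> {0..2*pi} \<Longrightarrow> f t = g t) \<Longrightarrow> mean f = mean g"
  unfolding mean_def by (metis integral_cong)

lemma mean_linear:
  assumes "bounded_linear h" "continuous_on {0..2*pi} g"
  shows "mean (\<lambda>t. h (g t)) = h (mean g)"
  using integral_linear[OF integrable_continuous_interval[OF assms(2)] assms(1)]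
  by (simp add: mean_def o_def linear_simps[OF assms(1)])

lemma mean_mult_left:
  fixes g :: "real \<Rightarrow> 'a :: {real_normed_field, banach}"
  shows "continuous_on {0..2*pi} g \<Longrightarrow> mean (\<lambda>t. c * g t) = c * mean g"
  by (rule mean_linear[OF bounded_linear_mult_right])

lemma mean_of_real:
  "continuous_on {0..2*pi} g \<Longrightarrow> mean (\<lambda>t. complex_of_real (g t)) = of_real (mean g)"
  by (rule mean_linear[OF bounded_linear_of_real])

lemma mean_Re: "continuous_on {0..2*pi} g \<Longrightarrow> mean (\<lambda>t. Re (g t)) = Re (mean g)"
  by (rule mean_linear[OF bounded_linear_Re])

lemma mean_cnj: "continuous_on {0..2*pi} g \<Longrightarrow> mean (\<lambda>t. cnj (g t)) = cnj (mean g)"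
  by (rule mean_linear[OF bounded_linear_cnj])

lemma mean_add:
  "continuous_on {0..2*pi} f \<Longrightarrow> continuous_on {0..2*pi} g \<Longrightarrow>
    mean (\<lambda>t. f t + g t) = mean f + mean g"
  by (simp add: mean_def integral_add integrable_continuous_interval scaleR_right_distrib)

lemma mean_diff:
  "continuous_on {0..2*pi} f \<Longrightarrow> continuous_on {0..2*pi} g \<Longrightarrow>
    mean (\<lambda>t. f t - g t) = mean f - mean g"
  by (simp add: mean_def integral_diff integrable_continuous_interval scaleR_right_diff_distrib)

lemma mean_sum:
  "finite I \<Longrightarrow> (\<And>i. i \<in> I \<Longrightarrow> continuous_on {0..2*pi} (f i)) \<Longrightarrow>
    mean (\<lambda>t. \<Sum>i\<in>I. f i t) = (\<Sum>i\<in>I. mean (f i))"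
  by (simp add: mean_def integral_sum integrable_continuous_interval scaleR_sum_right)

lemma mean_const: "mean (\<lambda>t. c) = c"
  by (simp add: mean_def)

lemma mean_mono:
  fixes f g :: "real \<Rightarrow> real"
  assumes "continuous_on {0..2*pi} f" "continuous_on {0..2*pi} g"
    "\<And>t. t \<in> {0..2*pi} \<Longrightarrow> f t \<le> g t"
  shows "mean f \<le> mean g"
  unfolding mean_def
  by (intro scaleR_left_mono integral_le integrable_continuous_interval assms) auto

lemma mean_cis: "mean (\<lambda>t. cis (of_int n * t)) = (if n = 0 then 1 else 0)"
proof (cases "n = 0")
  case True
  then show ?thesis by (simp add: mean_const cis_zero)
next
  case False
  define F where "F z = exp (\<i> * of_int n * z) / (\<i> * of_int n)" for z :: complex
  have F: "(F has_field_derivative exp (\<i> * of_int n * z)) (at z)" for z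
    unfolding F_def using False by (auto intro!: derivative_eq_intros)
  have "((\<lambda>t. exp (\<i> * of_int n * of_real t)) has_integral (F (of_real (2 * pi)) - F (of_real 0))) {0..2*pi}"
    by (rule fundamental_theorem_of_calculus)
       (use has_vector_derivative_real_field[OF F] in auto)
  moreover have "exp (\<i> * of_int n * of_real t) = cis (of_int n * t)" for t
    by (simp add: cis_conv_exp mult_ac)
  moreover have "F (of_real (2 * pi)) = F (of_real 0)"
  proof -
    have "exp (\<i> * of_int n * of_real (2 * pi)) = 1"
      using exp_integer_2pi[of "of_int n"] by (simp add: mult_ac)
    then show ?thesis by (simp add: F_def)
  qed
  ultimately show ?thesis using False by (simp add: mean_def integral_unique)
qed

lemma fourier_coeff_eq_mean: "fourier_coeff a k = mean (\<lambda>t. a t * cis (- (of_int k * t)))"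
proof -
  have "exp (- \<i> * of_int k * of_real t) = cis (- (of_int k * t))" for t
    by (simp add: cis_conv_exp mult_ac)
  then show ?thesis
    unfolding fourier_coeff_def mean_def by (simp add: scaleR_conv_of_real)
qed

lemma fourier_coeff_cong:
  "(\<And>t. t \<in> {0..2*pi} \<Longrightarrow> a t = b t) \<Longrightarrow> fourier_coeff a k = fourier_coeff b k"
  unfolding fourier_coeff_eq_mean by (rule mean_cong) simp

lemma fourier_coeff_add:
  assumes "continuous_on {0..2*pi} a" "continuous_on {0..2*pi} b"
  shows "fourier_coeff (\<lambda>t. a t + b t) k = fourier_coeff a k + fourier_coeff b k"
proof -
  have "mean (\<lambda>t. a t * cis (- (of_int k * t)) + b t * cis (- (of_int k * t)))
      = fourier_coeff a k + fourier_coeff b k"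
    unfolding fourier_coeff_eq_mean by (intro mean_add continuous_intros assms)
  then show ?thesis by (simp add: fourier_coeff_eq_mean distrib_right)
qed

lemma fourier_coeff_cmult:
  assumes "continuous_on {0..2*pi} a"
  shows "fourier_coeff (\<lambda>t. c * a t) k = c * fourier_coeff a k"
  unfolding fourier_coeff_eq_mean mult.assoc
  by (intro mean_mult_left continuous_intros assms)

lemma fourier_coeff_sum:
  assumes "finite I" "\<And>i. i \<in> I \<Longrightarrow> continuous_on {0..2*pi} (a i)"
  shows "fourier_coeff (\<lambda>t. \<Sum>i\<in>I. a i t) k = (\<Sum>i\<in>I. fourier_coeff (a i) k)"
  unfolding fourier_coeff_eq_mean sum_distrib_right
  by (intro mean_sum continuous_intros assms)

lemma fourier_coeff_shift: "fourier_coeff (\<lambda>t. cis (of_int k * t) * b t) m = fourier_coeff b (m - k)"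
proof -
  have "cis (of_int k * t) * b t * cis (- (of_int m * t)) = b t * cis (- (of_int (m - k) * t))" for t
    by (simp add: cis_mult algebra_simps)
  then show ?thesis unfolding fourier_coeff_eq_mean by (simp only:)
qed

lemma fourier_coeff_cis: "fourier_coeff (\<lambda>t. cis (of_int k * t)) m = (if m = k then 1 else 0)"
  using fourier_coeff_shift[of k "\<lambda>_. 1" m] mean_cis[of "k - m"]
  by (simp add: fourier_coeff_eq_mean algebra_simps)

lemma fourier_coeff_cnj:
  assumes "continuous_on {0..2*pi} a"
  shows "fourier_coeff (\<lambda>t. cnj (a t)) k = cnj (fourier_coeff a (- k))"
proof -
  have "cnj (fourier_coeff a (- k)) = mean (\<lambda>t. cnj (a t * cis (of_int k * t)))"
    unfolding fourier_coeff_eq_mean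
    by (subst mean_cnj) (auto intro!: continuous_intros assms)
  then show ?thesis by (simp add: fourier_coeff_eq_mean cis_cnj)
qed

text \<open>The function on the circle whose multiplication by a symbol gives, after projection, the
  Toeplitz operator: with entries \<open>a\<^sub>j\<^sub>-\<^sub>i\<close> it has to be built from the frequencies \<open>0, -1, -2, \<dots>\<close>.\<close>

definition trig_sum :: "nat \<Rightarrow> (nat \<Rightarrow> complex) \<Rightarrow> real \<Rightarrow> complex"
  where "trig_sum N u t = (\<Sum>j<N. u j * cis (- (real j * t)))"

lemma continuous_on_trig_sum [continuous_intros]: "continuous_on S (trig_sum N u)"
  unfolding trig_sum_def by (intro continuous_intros)

text \<open>For \<open>m = - int i\<close> the sum is entry \<open>i\<close> of the Toeplitz matrix
  of \<open>b\<close> applied to \<open>u\<close>: multiply by \<open>b\<close>, then read off the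
  nonpositive frequencies.\<close>

lemma fourier_coeff_mult_trig_sum:
  assumes b: "continuous_on {0..2*pi} b"
  shows "fourier_coeff (\<lambda>t. b t * trig_sum N u t) m = (\<Sum>j<N. u j * fourier_coeff b (m + int j))"
proof -
  have "(\<lambda>t. b t * trig_sum N u t) = (\<lambda>t. \<Sum>j<N. u j * (cis (of_int (- int j) * t) * b t))"
    by (simp add: trig_sum_def sum_distrib_left mult_ac)
  then have "fourier_coeff (\<lambda>t. b t * trig_sum N u t) m
      = (\<Sum>j<N. fourier_coeff (\<lambda>t. u j * (cis (of_int (- int j) * t) * b t)) m)"
    by (simp only:) (rule fourier_coeff_sum; intro finite_lessThan continuous_intros b)
  also have "\<dots> = (\<Sum>j<N. u j * fourier_coeff (\<lambda>t. cis (of_int (- int j) * t) * b t) m)"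
    by (intro sum.cong refl fourier_coeff_cmult continuous_intros b)
  finally show ?thesis by (simp only: fourier_coeff_shift) simp
qed

lemma fourier_coeff_trig_sum:
  assumes "i < N" shows "fourier_coeff (trig_sum N u) (- int i) = u i"
proof -
  have one: "fourier_coeff (\<lambda>t. 1) m = (if m = 0 then 1 else 0)" for m
    using fourier_coeff_cis[of 0 m] by (simp add: cis_zero)
  have "fourier_coeff (trig_sum N u) (- int i) = (\<Sum>j<N. u j * fourier_coeff (\<lambda>t. 1) (- int i + int j))"
    using fourier_coeff_mult_trig_sum[of "\<lambda>t. 1" N u "- int i"] by simp
  also have "\<dots> = (\<Sum>j<N. if j = i then u j else 0)"
    by (intro sum.cong refl) (simp add: one)
  finally show ?thesis using assms by simp
qed

section \<open>Parseval's identity and Bessel's inequality\<close>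

lemma mean_mult_cnj_trig_sum:
  assumes g: "continuous_on {0..2*pi} g"
  shows "mean (\<lambda>t. g t * cnj (trig_sum N u t)) = (\<Sum>i<N. cnj (u i) * fourier_coeff g (- int i))"
proof -
  have "mean (\<lambda>t. g t * cnj (trig_sum N u t))
      = mean (\<lambda>t. \<Sum>i<N. cnj (u i) * (g t * cis (real i * t)))"
    by (simp add: trig_sum_def sum_distrib_left mult_ac cis_cnj)
  also have "\<dots> = (\<Sum>i<N. mean (\<lambda>t. cnj (u i) * (g t * cis (real i * t))))"
    by (intro mean_sum finite_lessThan continuous_intros g)
  also have "\<dots> = (\<Sum>i<N. cnj (u i) * mean (\<lambda>t. g t * cis (real i * t)))"
    by (intro sum.cong refl mean_mult_left continuous_intros g)
  finally show ?thesis by (simp add: fourier_coeff_eq_mean)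
qed

lemma parseval_trig_sum: "mean (\<lambda>t. (cmod (trig_sum N u t))\<^sup>2) = (\<Sum>i<N. (cmod (u i))\<^sup>2)"
proof -
  have "complex_of_real (mean (\<lambda>t. (cmod (trig_sum N u t))\<^sup>2))
      = mean (\<lambda>t. trig_sum N u t * cnj (trig_sum N u t))"
    by (simp only: complex_norm_square
      flip: mean_of_real[OF continuous_on_power[OF continuous_on_norm[OF continuous_on_trig_sum]]])
  also have "\<dots> = (\<Sum>i<N. cnj (u i) * fourier_coeff (trig_sum N u) (- int i))"
    by (rule mean_mult_cnj_trig_sum[OF continuous_on_trig_sum])
  also have "\<dots> = (\<Sum>i<N. of_real ((cmod (u i))\<^sup>2))"
    by (intro sum.cong refl) (simp only: fourier_coeff_trig_sum complex_norm_square lessThan_iff mult.commute)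
  also have "\<dots> = of_real (\<Sum>i<N. (cmod (u i))\<^sup>2)" by (rule of_real_sum[symmetric])
  finally show ?thesis by (simp only: of_real_eq_iff)
qed

lemma bessel_inequality:
  assumes g: "continuous_on {0..2*pi} g"
  shows "(\<Sum>i<N. (cmod (fourier_coeff g (- int i)))\<^sup>2) \<le> mean (\<lambda>t. (cmod (g t))\<^sup>2)"
proof -
  define u where "u i = fourier_coeff g (- int i)" for i
  \<comment> \<open>The orthogonal projection of \<open>g\<close> to the first \<open>N\<close>
    nonpositive frequencies. Both the cross term and the mean of its squared modulus equal
    \<open>\<sigma>\<close>, so expanding the squared modulus of \<open>g - s\<close> leaves the
    claim.\<close>
  define s where "s = trig_sum N u"
  define \<sigma> where "\<sigma> = (\<Sum>i<N. (cmod (u i))\<^sup>2)"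
  have s: "continuous_on {0..2*pi} s" unfolding s_def by (rule continuous_on_trig_sum)
  have "mean (\<lambda>t. g t * cnj (s t)) = of_real \<sigma>"
    unfolding s_def \<sigma>_def mean_mult_cnj_trig_sum[OF g] of_real_sum
    by (intro sum.cong refl) (simp only: u_def complex_norm_square mult.commute)
  then have cross: "mean (\<lambda>t. Re (g t * cnj (s t))) = \<sigma>"
    using mean_Re[of "\<lambda>t. g t * cnj (s t)"] by (simp add: continuous_intros g s)
  have "0 \<le> mean (\<lambda>t. (cmod (g t - s t))\<^sup>2)"
    using mean_mono[of "\<lambda>_. 0" "\<lambda>t. (cmod (g t - s t))\<^sup>2"]
      by (simp add: mean_const continuous_intros g s)
  also have "(\<lambda>t. (cmod (g t - s t))\<^sup>2)
    = (\<lambda>t. (cmod (g t))\<^sup>2 - 2 * Re (g t * cnj (s t)) + (cmod (s t))\<^sup>2)"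
    unfolding norm_diff_sq by (simp add: inner_complex_def)
  also have "mean \<dots> = mean (\<lambda>t. (cmod (g t))\<^sup>2) - 2 * \<sigma> + \<sigma>"
  proof -
    have "mean (\<lambda>t. (cmod (g t))\<^sup>2 - 2 * Re (g t * cnj (s t)) + (cmod (s t))\<^sup>2)
        = mean (\<lambda>t. (cmod (g t))\<^sup>2 - 2 * Re (g t * cnj (s t))) + mean (\<lambda>t. (cmod (s t))\<^sup>2)"
      by (intro mean_add continuous_intros g s)
    also have "mean (\<lambda>t. (cmod (g t))\<^sup>2 - 2 * Re (g t * cnj (s t)))
        = mean (\<lambda>t. (cmod (g t))\<^sup>2) - mean (\<lambda>t. 2 * Re (g t * cnj (s t)))"
      by (intro mean_diff continuous_intros g s)
    also have "mean (\<lambda>t. 2 * Re (g t * cnj (s t))) = 2 * mean (\<lambda>t. Re (g t * cnj (s t)))"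
      by (intro mean_mult_left continuous_intros g s)
    also have "mean (\<lambda>t. (cmod (s t))\<^sup>2) = \<sigma>"
      unfolding s_def \<sigma>_def by (rule parseval_trig_sum)
    finally show ?thesis by (simp only: cross)
  qed
  finally show ?thesis by (simp add: \<sigma>_def u_def)
qed

section \<open>Toeplitz operators\<close>

definition fin_ell2 :: "nat \<Rightarrow> (nat \<Rightarrow> complex) \<Rightarrow> ell2"
  where "fin_ell2 N u = Abs_ell2 (\<lambda>n. if n < N then u n else 0)"

lemma ell2_nth_fin_ell2 [simp]: "ell2_nth (fin_ell2 N u) n = (if n < N then u n else 0)"
proof -
  have "summable (\<lambda>n. (cmod (if n < N then u n else 0))\<^sup>2)"
    by (rule summable_finite[of "{..<N}"]) auto
  then show ?thesis by (simp add: fin_ell2_def Abs_ell2_inverse)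
qed

lemma norm_fin_ell2: "(norm (fin_ell2 N u))\<^sup>2 = (\<Sum>i<N. (cmod (u i))\<^sup>2)"
  unfolding norm_ell2_sq by (subst suminf_finite[of "{..<N}"]) auto

text \<open>The squared distance is a tail of the convergent norm series. Forms of Toeplitz
  operators are computed as integrals on finite vectors and extended by this density.\<close>

lemma fin_ell2_tendsto: "(\<lambda>N. fin_ell2 N (ell2_nth x)) \<longlonglongrightarrow> x"
proof -
  have "(norm (fin_ell2 N (ell2_nth x) - x))\<^sup>2 = (norm x)\<^sup>2 - (\<Sum>i<N. (cmod (ell2_nth x i))\<^sup>2)" for N
  proof -
    have "(norm (fin_ell2 N (ell2_nth x) - x))\<^sup>2
        = (\<Sum>n. (cmod (ell2_nth (fin_ell2 N (ell2_nth x) - x) (n + N)))\<^sup>2)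
          + (\<Sum>n<N. (cmod (ell2_nth (fin_ell2 N (ell2_nth x) - x) n))\<^sup>2)"
      unfolding norm_ell2_sq by (rule suminf_split_initial_segment[OF summable_ell2_nth])
    also have "\<dots> = (\<Sum>n. (cmod (ell2_nth x (n + N)))\<^sup>2)" by simp
    finally show ?thesis
      unfolding norm_ell2_sq[of x]
      using suminf_split_initial_segment[OF summable_ell2_nth[of x], of N] by simp
  qed
  moreover have "(\<lambda>N. (norm x)\<^sup>2 - (\<Sum>i<N. (cmod (ell2_nth x i))\<^sup>2)) \<longlonglongrightarrow> (norm x)\<^sup>2 - (norm x)\<^sup>2"
    unfolding norm_ell2_sq by (intro tendsto_intros summable_LIMSEQ summable_ell2_nth)
  ultimately have "(\<lambda>N. (norm (fin_ell2 N (ell2_nth x) - x))\<^sup>2) \<longlonglongrightarrow> 0" by simp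
  from tendsto_real_sqrt[OF this] have "(\<lambda>N. norm (fin_ell2 N (ell2_nth x) - x)) \<longlonglongrightarrow> 0" by simp
  then show ?thesis by (simp add: LIM_zero_cancel tendsto_norm_zero_iff)
qed

section \<open>Convergence and boundedness of the Toeplitz matrix\<close>

lemma summable_if_bounded_sums:
  fixes f :: "nat \<Rightarrow> real"
  assumes "\<And>n. 0 \<le> f n" "\<And>N. (\<Sum>n<N. f n) \<le> B"
  shows "summable f"
  by (rule bounded_imp_summable[where B = B]) (simp_all only: assms flip: lessThan_Suc_atMost)

lemma summable_toeplitz_row:
  assumes b: "continuous_on {0..2*pi} b"
  shows "summable (\<lambda>j. fourier_coeff b (int j - int i) * ell2_nth x j)"
proof -
  let ?r = "\<lambda>j. fourier_coeff b (int j - int i)"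
  \<comment> \<open>Row \<open>i\<close> has the frequencies \<open>j - i\<close>, which grow with
    \<open>j\<close>, while \<open>bessel_inequality\<close> treats nonpositive ones. Conjugation
    reverses the sign and the exponential removes the offset \<open>i\<close>.\<close>
  define g where "g t = cis (of_int (- int i) * t) * cnj (b t)" for t
  have g: "continuous_on {0..2*pi} g" unfolding g_def by (intro continuous_intros b)
  have "cmod (?r j) = cmod (fourier_coeff g (- int j))" for j
    unfolding g_def fourier_coeff_shift fourier_coeff_cnj[OF b] complex_mod_cnj
    by (simp add: algebra_simps)
  then have "(\<Sum>j<N. (cmod (?r j))\<^sup>2) \<le> mean (\<lambda>t. (cmod (g t))\<^sup>2)" for N
    using bessel_inequality[OF g, of N] by simp
  then have "summable (\<lambda>j. (cmod (?r j))\<^sup>2)"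
    by (rule summable_if_bounded_sums[OF zero_le_power2])
  then have r: "ell2_nth (Abs_ell2 ?r) = ?r" by (simp add: Abs_ell2_inverse)
  show ?thesis
    by (rule summable_comparison_test'[OF summable_norm_mult_ell2[of "Abs_ell2 ?r" x]])
       (simp add: r norm_mult)
qed

lemma toeplitz_section_bound:
  assumes b: "continuous_on {0..2*pi} b"
  shows "(\<Sum>i<N. (cmod (\<Sum>j<M. fourier_coeff b (int j - int i) * u j))\<^sup>2)
    \<le> mean (\<lambda>t. (cmod (b t * trig_sum M u t))\<^sup>2)"
proof -
  have "(\<Sum>j<M. fourier_coeff b (int j - int i) * u j)
      = fourier_coeff (\<lambda>t. b t * trig_sum M u t) (- int i)" for i
    by (simp add: fourier_coeff_mult_trig_sum[OF b] mult.commute)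
  moreover have "continuous_on {0..2*pi} (\<lambda>t. b t * trig_sum M u t)" by (intro continuous_intros b)
  ultimately show ?thesis by (simp only: bessel_inequality)
qed

lemma mean_mult_trig_sum_le:
  assumes b: "continuous_on {0..2*pi} b" "\<And>t. t \<in> {0..2*pi} \<Longrightarrow> cmod (b t) \<le> C"
  shows "mean (\<lambda>t. (cmod (b t * trig_sum M u t))\<^sup>2) \<le> C\<^sup>2 * (\<Sum>j<M. (cmod (u j))\<^sup>2)"
proof -
  have "mean (\<lambda>t. (cmod (b t * trig_sum M u t))\<^sup>2) \<le> mean (\<lambda>t. C\<^sup>2 * (cmod (trig_sum M u t))\<^sup>2)"
    by (rule mean_mono)
       (auto intro!: continuous_intros b mult_right_mono power_mono simp: norm_mult power_mult_distrib)
  also have "\<dots> = C\<^sup>2 * mean (\<lambda>t. (cmod (trig_sum M u t))\<^sup>2)"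
    by (intro mean_mult_left continuous_intros)
  finally show ?thesis by (simp add: parseval_trig_sum)
qed

text \<open>With \<open>N\<close> fixed only finitely many rows occur, so the column cutoff
  \<open>M\<close> can tend to infinity. The bound depends on neither cutoff.\<close>

lemma toeplitz_row_square_sum_bound:
  assumes b: "continuous_on {0..2*pi} b" "\<And>t. t \<in> {0..2*pi} \<Longrightarrow> cmod (b t) \<le> C"
  shows "(\<Sum>i<N. (cmod (\<Sum>j. fourier_coeff b (int j - int i) * ell2_nth x j))\<^sup>2) \<le> C\<^sup>2 * (norm x)\<^sup>2"
proof (rule LIMSEQ_le_const2)
  show "(\<lambda>M. \<Sum>i<N. (cmod (\<Sum>j<M. fourier_coeff b (int j - int i) * ell2_nth x j))\<^sup>2)
      \<longlonglongrightarrow> (\<Sum>i<N. (cmod (\<Sum>j. fourier_coeff b (int j - int i) * ell2_nth x j))\<^sup>2)"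
    by (intro tendsto_intros summable_LIMSEQ summable_toeplitz_row b)
  have "(\<Sum>i<N. (cmod (\<Sum>j<M. fourier_coeff b (int j - int i) * ell2_nth x j))\<^sup>2) \<le> C\<^sup>2 * (norm x)\<^sup>2" for M
  proof -
    have "(\<Sum>i<N. (cmod (\<Sum>j<M. fourier_coeff b (int j - int i) * ell2_nth x j))\<^sup>2)
        \<le> mean (\<lambda>t. (cmod (b t * trig_sum M (ell2_nth x) t))\<^sup>2)"
      by (rule toeplitz_section_bound[OF b(1)])
    also have "\<dots> \<le> C\<^sup>2 * (\<Sum>j<M. (cmod (ell2_nth x j))\<^sup>2)"
      by (rule mean_mult_trig_sum_le[OF b])
    also have "\<dots> \<le> C\<^sup>2 * (norm x)\<^sup>2"
      by (intro mult_left_mono sum_cmod_sq_le_norm_ell2 zero_le_power2)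
    finally show ?thesis .
  qed
  then show "\<exists>K. \<forall>M\<ge>K. (\<Sum>i<N. (cmod (\<Sum>j<M. fourier_coeff b (int j - int i) * ell2_nth x j))\<^sup>2)
      \<le> C\<^sup>2 * (norm x)\<^sup>2"
    by blast
qed

lemma continuous_bound:
  assumes "continuous_on {0..2*pi} b"
  obtains C where "C > 0" "\<And>t. t \<in> {0..2*pi} \<Longrightarrow> norm (b t) \<le> C"
  using compact_imp_bounded[OF compact_continuous_image[OF assms compact_Icc]]
  unfolding bounded_pos by auto

lemma ell2_nth_toeplitz:
  assumes b: "continuous_on {0..2*pi} b"
  shows "ell2_nth (toeplitz b x) i = (\<Sum>j. fourier_coeff b (int j - int i) * ell2_nth x j)"
proof -
  obtain C where "\<And>t. t \<in> {0..2*pi} \<Longrightarrow> cmod (b t) \<le> C" using continuous_bound[OF b] by blast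
  from toeplitz_row_square_sum_bound[OF b this]
  have "summable (\<lambda>i. (cmod (\<Sum>j. fourier_coeff b (int j - int i) * ell2_nth x j))\<^sup>2)"
    by (intro summable_if_bounded_sums) auto
  then show ?thesis by (simp add: toeplitz_def Abs_ell2_inverse)
qed

lemma norm_sq_le_if_sections:
  assumes "\<And>N. (\<Sum>i<N. (cmod (ell2_nth x i))\<^sup>2) \<le> B"
  shows "(norm x)\<^sup>2 \<le> B"
  unfolding norm_ell2_sq by (intro suminf_le_const summable_ell2_nth assms)

lemma norm_toeplitz_le:
  assumes b: "continuous_on {0..2*pi} b" "\<And>t. t \<in> {0..2*pi} \<Longrightarrow> cmod (b t) \<le> C"
  shows "norm (toeplitz b x) \<le> C * norm x"
proof (rule power2_le_imp_le)
  show "(norm (toeplitz b x))\<^sup>2 \<le> (C * norm x)\<^sup>2"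
    unfolding power_mult_distrib
    by (rule norm_sq_le_if_sections)
       (simp only: ell2_nth_toeplitz[OF b(1)] toeplitz_row_square_sum_bound[OF b])
  have "0 \<le> C" using b(2)[of 0]
    by (meson norm_ge_zero order_trans atLeastAtMost_iff order_refl pi_ge_zero mult_nonneg_nonneg zero_le_numeral)
  then show "0 \<le> C * norm x" by simp
qed

lemma bounded_op_toeplitz:
  assumes b: "continuous_on {0..2*pi} b" shows "bounded_op (toeplitz b)"
proof -
  obtain C where C: "\<And>t. t \<in> {0..2*pi} \<Longrightarrow> cmod (b t) \<le> C" using continuous_bound[OF b] by blast
  note s = summable_toeplitz_row[OF b]
  show ?thesis
  proof (rule bounded_op_intro)
    show "toeplitz b (x + y) = toeplitz b x + toeplitz b y" for x y
      by (rule ell2_eqI) (simp add: ell2_nth_toeplitz[OF b] distrib_left suminf_add[OF s s])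
    show "toeplitz b (c *\<^sub>C x) = c *\<^sub>C toeplitz b x" for c x
      by (rule ell2_eqI) (simp add: ell2_nth_toeplitz[OF b] mult.left_commute[of _ c] suminf_mult[OF s])
    show "norm (toeplitz b x) \<le> C * norm x" for x by (rule norm_toeplitz_le[OF b C])
  qed
qed

lemma toeplitz_add:
  assumes a: "continuous_on {0..2*pi} a" and b: "continuous_on {0..2*pi} b"
  shows "toeplitz (\<lambda>t. a t + b t) x = toeplitz a x + toeplitz b x"
  by (rule ell2_eqI)
     (simp add: ell2_nth_toeplitz a b continuous_on_add fourier_coeff_add distrib_right suminf_add
        summable_toeplitz_row)

lemma toeplitz_cmult:
  assumes a: "continuous_on {0..2*pi} a"
  shows "toeplitz (\<lambda>t. c * a t) x = c *\<^sub>C toeplitz a x"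
  by (rule ell2_eqI)
     (simp add: ell2_nth_toeplitz a continuous_on_mult_left fourier_coeff_cmult mult.assoc suminf_mult
        summable_toeplitz_row)

lemma toeplitz_diff:
  assumes a: "continuous_on {0..2*pi} a" and b: "continuous_on {0..2*pi} b"
  shows "toeplitz (\<lambda>t. a t - b t) x = toeplitz a x - toeplitz b x"
  using toeplitz_add[OF a continuous_on_mult_left[OF b, of "-1"], of x] toeplitz_cmult[OF b, of "-1" x]
  by (simp add: scaleC_minus)

section \<open>Toeplitz operators on finite vectors and their quadratic forms\<close>

lemma ell2_nth_toeplitz_fin:
  assumes b: "continuous_on {0..2*pi} b"
  shows "ell2_nth (toeplitz b (fin_ell2 N u)) i = fourier_coeff (\<lambda>t. b t * trig_sum N u t) (- int i)"
  unfolding ell2_nth_toeplitz[OF b] fourier_coeff_mult_trig_sum[OF b]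
  by (subst suminf_finite[of "{..<N}"]) (auto intro!: sum.cong simp: mult.commute)

lemma norm_toeplitz_fin_le:
  assumes b: "continuous_on {0..2*pi} b"
  shows "(norm (toeplitz b (fin_ell2 N u)))\<^sup>2 \<le> mean (\<lambda>t. (cmod (b t * trig_sum N u t))\<^sup>2)"
  by (rule norm_sq_le_if_sections)
     (simp only: ell2_nth_toeplitz_fin[OF b], intro bessel_inequality continuous_intros b)

text \<open>The only possible nonzero entry of row \<open>i\<close> is in column
  \<open>i + k\<close>: a backward shift for positive \<open>k\<close>; for negative
  \<open>k\<close> a forward shift, whose first \<open>- k\<close> rows vanish.\<close>

lemma toeplitz_cis_nth:
  "ell2_nth (toeplitz (\<lambda>t. cis (of_int k * t)) x) i
    = (if 0 \<le> int i + k then ell2_nth x (nat (int i + k)) else 0)"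
proof -
  have c: "continuous_on {0..2*pi} (\<lambda>t. cis (of_int k * t))" by (intro continuous_intros)
  have eq: "fourier_coeff (\<lambda>t. cis (of_int k * t)) (int j - int i) * ell2_nth x j
      = (if int j = int i + k then ell2_nth x j else 0)" for j
    by (auto simp: fourier_coeff_cis)
  show ?thesis unfolding ell2_nth_toeplitz[OF c] eq
    by (subst suminf_finite[of "if 0 \<le> int i + k then {nat (int i + k)} else {}"]) auto
qed

lemma toeplitz_one: "toeplitz (\<lambda>t. 1) x = x"
  using toeplitz_cis_nth[of 0 x] by (intro ell2_eqI) (simp add: cis_zero)

lemma toeplitz_const: "toeplitz (\<lambda>t. c) x = c *\<^sub>C x"
  using toeplitz_cmult[of "\<lambda>t. 1" c x] by (simp add: toeplitz_one)

text \<open>The second factor only contains frequencies that the projection keeps, so the projection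
  disappears from the inner product.\<close>

lemma inner_toeplitz_fin:
  assumes b: "continuous_on {0..2*pi} b"
  shows "inner (toeplitz b (fin_ell2 N u)) (fin_ell2 M v)
    = mean (\<lambda>t. Re (b t * trig_sum N u t * cnj (trig_sum M v t)))"
proof -
  have c: "continuous_on {0..2*pi} (\<lambda>t. b t * trig_sum N u t)" by (intro continuous_intros b)
  have "cinner_ell2 (toeplitz b (fin_ell2 N u)) (fin_ell2 M v)
      = (\<Sum>i<M. cnj (v i) * fourier_coeff (\<lambda>t. b t * trig_sum N u t) (- int i))"
    unfolding cinner_ell2_def
    by (subst suminf_finite[of "{..<M}"]) (auto simp: ell2_nth_toeplitz_fin[OF b] mult.commute)
  also have "\<dots> = mean (\<lambda>t. b t * trig_sum N u t * cnj (trig_sum M v t))"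
    by (rule mean_mult_cnj_trig_sum[OF c, symmetric])
  finally show ?thesis
    unfolding inner_ell2_eq_Re_cinner
    by (simp only:) (rule mean_Re[symmetric], intro continuous_intros b)
qed

lemma toeplitz_fin_tendsto:
  assumes b: "continuous_on {0..2*pi} b"
  shows "(\<lambda>N. toeplitz b (fin_ell2 N (ell2_nth x))) \<longlonglongrightarrow> toeplitz b x"
  by (rule bounded_linear.tendsto[OF bounded_opD(1)[OF bounded_op_toeplitz[OF b]] fin_ell2_tendsto])

lemma self_adjoint_toeplitz:
  assumes a: "continuous_on {0..2*pi} a" and real: "\<And>t. t \<in> {0..2*pi} \<Longrightarrow> a t \<in> \<real>"
  shows "self_adjoint (toeplitz a)"
  unfolding self_adjoint_iff
proof (intro conjI allI bounded_op_toeplitz a)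
  fix x y
  let ?x = "\<lambda>N. fin_ell2 N (ell2_nth x)" and ?y = "\<lambda>N. fin_ell2 N (ell2_nth y)"
  have eq: "inner (toeplitz a (?x N)) (?y N) = inner (?x N) (toeplitz a (?y N))" for N
  proof -
    have "Re (a t * u * cnj v) = Re (a t * v * cnj u)" if "t \<in> {0..2*pi}" for t u v
      using real[OF that] by (auto elim!: Reals_cases simp: algebra_simps)
    then show ?thesis
      unfolding inner_commute[of "?x N"] inner_toeplitz_fin[OF a] by (rule mean_cong)
  qed
  have "(\<lambda>N. inner (toeplitz a (?x N)) (?y N)) \<longlonglongrightarrow> inner (toeplitz a x) y"
    by (intro tendsto_inner toeplitz_fin_tendsto fin_ell2_tendsto a)
  moreover have "(\<lambda>N. inner (?x N) (toeplitz a (?y N))) \<longlonglongrightarrow> inner x (toeplitz a y)"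
    by (intro tendsto_inner toeplitz_fin_tendsto fin_ell2_tendsto a)
  ultimately show "inner (toeplitz a x) y = inner x (toeplitz a y)"
    unfolding eq by (rule LIMSEQ_unique)
qed

text \<open>On a finite vector the form is the mean of \<open>Re (a t)\<close> times the squared
  modulus of its trigonometric sum, and the mean of that squared modulus is the squared
  norm.\<close>

lemma toeplitz_numerical_range:
  assumes a: "continuous_on {0..2*pi} a" and bounds: "\<And>t. t \<in> {0..2*pi} \<Longrightarrow> m \<le> Re (a t) \<and> Re (a t) \<le> M"
  shows "m * (norm x)\<^sup>2 \<le> inner (toeplitz a x) x" "inner (toeplitz a x) x \<le> M * (norm x)\<^sup>2"
proof -
  let ?x = "\<lambda>N. fin_ell2 N (ell2_nth x)" and ?s = "\<lambda>N. trig_sum N (ell2_nth x)"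
  have c: "continuous_on {0..2*pi} (\<lambda>t. Re (a t * ?s N t * cnj (?s N t)))" 
    "continuous_on {0..2*pi} (\<lambda>t. k * (cmod (?s N t))\<^sup>2)" for N k
    by (intro continuous_intros a)+
  have eq: "Re (a t * w * cnj w) = Re (a t) * (cmod w)\<^sup>2" for t w
    by (simp only: mult.assoc flip: complex_norm_square) simp
  have norm: "mean (\<lambda>t. k * (cmod (?s N t))\<^sup>2) = k * (norm (?x N))\<^sup>2" for k N
    unfolding norm_fin_ell2 parseval_trig_sum[symmetric] by (intro mean_mult_left continuous_intros)
  have lower: "m * (norm (?x N))\<^sup>2 \<le> inner (toeplitz a (?x N)) (?x N)" for N
    unfolding norm[symmetric] inner_toeplitz_fin[OF a]
    by (rule mean_mono[OF c(2,1)], unfold eq) (use bounds in \<open>auto intro!: mult_right_mono\<close>)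
  have upper: "inner (toeplitz a (?x N)) (?x N) \<le> M * (norm (?x N))\<^sup>2" for N
    unfolding norm[symmetric] inner_toeplitz_fin[OF a]
    by (rule mean_mono[OF c(1,2)], unfold eq) (use bounds in \<open>auto intro!: mult_right_mono\<close>)
  have lim: "(\<lambda>N. inner (toeplitz a (?x N)) (?x N)) \<longlonglongrightarrow> inner (toeplitz a x) x"
    by (intro tendsto_inner toeplitz_fin_tendsto fin_ell2_tendsto a)
  have limn: "(\<lambda>N. k * (norm (?x N))\<^sup>2) \<longlonglongrightarrow> k * (norm x)\<^sup>2" for k
    by (intro tendsto_intros fin_ell2_tendsto)
  show "m * (norm x)\<^sup>2 \<le> inner (toeplitz a x) x"
    by (rule LIMSEQ_le[OF limn lim]) (use lower in blast)
  show "inner (toeplitz a x) x \<le> M * (norm x)\<^sup>2"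
    by (rule LIMSEQ_le[OF lim limn]) (use upper in blast)
qed

section \<open>Trigonometric polynomials\<close>

text \<open>A trigonometric polynomial has frequencies of both signs. Here it is a polynomial in
  \<open>cis (- t)\<close>, thus a \<open>trig_sum\<close>, times one factor of modulus 1.\<close>

definition trig_poly :: "(real \<Rightarrow> complex) \<Rightarrow> bool"
  where "trig_poly p \<longleftrightarrow> (\<exists>N P. \<forall>t. p t = poly P (cis (- t)) * cis (real N * t))"

lemma trig_polyI: "(\<And>t. p t = poly P (cis (- t)) * cis (real N * t)) \<Longrightarrow> trig_poly p"
  unfolding trig_poly_def by blast

lemma trig_poly_const: "trig_poly (\<lambda>t. c)"
  by (rule trig_polyI[of _ "[:c:]" 0]) (simp add: cis_zero)

lemma trig_poly_mult:
  assumes "trig_poly p" "trig_poly q" shows "trig_poly (\<lambda>t. p t * q t)"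
proof -
  obtain N P M Q where p: "\<And>t. p t = poly P (cis (- t)) * cis (real N * t)"
    and q: "\<And>t. q t = poly Q (cis (- t)) * cis (real M * t)"
    using assms unfolding trig_poly_def by blast
  have "cis (real N * t) * cis (real M * t) = cis (real (N + M) * t)" for t
    by (simp add: cis_mult algebra_simps)
  then show ?thesis
    by (intro trig_polyI[of _ "P * Q" "N + M"]) (simp add: p q mult_ac flip: cis_mult)
qed

lemma trig_poly_add:
  assumes "trig_poly p" "trig_poly q" shows "trig_poly (\<lambda>t. p t + q t)"
proof -
  obtain N P M Q where p: "\<And>t. p t = poly P (cis (- t)) * cis (real N * t)"
    and q: "\<And>t. q t = poly Q (cis (- t)) * cis (real M * t)"
    using assms unfolding trig_poly_def by blast
  have shift: "cis (- t) ^ k * cis (real (k + l) * t) = cis (real l * t)" for k l t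
    by (simp add: Complex.DeMoivre cis_mult algebra_simps)
  \<comment> \<open>The two monomials bring the summands to the common exponential factor with
    frequency \<open>N + M\<close>.\<close>
  have "p t + q t = poly (P * monom 1 M + Q * monom 1 N) (cis (- t)) * cis (real (N + M) * t)" for t
    using shift[of t M N] shift[of t N M] by (simp add: p q poly_monom algebra_simps)
  then show ?thesis by (rule trig_polyI)
qed

lemma trig_poly_cos_sin: "trig_poly (\<lambda>t. of_real (cos t))" "trig_poly (\<lambda>t. of_real (sin t))"
proof -
  have e: "trig_poly (\<lambda>t. c * cis t)" "trig_poly (\<lambda>t. c * cis (- t))" for c
    by (rule trig_polyI[of _ "[:c:]" 1]; simp) (rule trig_polyI[of _ "[:0, c:]" 0]; simp add: cis_zero)
  have "complex_of_real (cos t) = 1 / 2 * cis t + 1 / 2 * cis (- t)"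
    "complex_of_real (sin t) = (- \<i> / 2) * cis t + (\<i> / 2) * cis (- t)" for t
    by (simp_all add: complex_eq_iff)
  then show "trig_poly (\<lambda>t. of_real (cos t))" "trig_poly (\<lambda>t. of_real (sin t))"
    by (simp_all only:) (intro trig_poly_add e)+
qed

lemma trig_poly_real_polynomial_function:
  fixes h :: "complex \<Rightarrow> real"
  assumes "real_polynomial_function h"
  shows "trig_poly (\<lambda>t. of_real (h (cis t)))"
  using assms
proof induction
  case (linear f)
  have "cis t = cos t *\<^sub>R 1 + sin t *\<^sub>R \<i>" for t by (simp add: complex_eq_iff)
  then have "complex_of_real (f (cis t)) = of_real (cos t) * of_real (f 1) + of_real (sin t) * of_real (f \<i>)" for t
    by (simp add: linear_simps[OF linear])
  then show ?case
    by (simp only:) (intro trig_poly_add trig_poly_mult trig_poly_cos_sin trig_poly_const)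
qed (simp_all add: trig_poly_const trig_poly_add trig_poly_mult)

text \<open>Stone-Weierstrass is applied on the unit circle, where real polynomials in the
  coordinates become polynomials in \<open>cos t\<close> and \<open>sin t\<close>.\<close>

lemma trig_poly_approx_real:
  fixes g :: "real \<Rightarrow> real"
  assumes g: "continuous_on {0..2*pi} g" "g 0 = g (2*pi)" and e: "e > 0"
  obtains p where "trig_poly p" "\<And>t. t \<in> {0..2*pi} \<Longrightarrow> cmod (p t - of_real (g t)) \<le> e"
proof -
  define G where "G z = g (Arg2pi z)" for z
  have G: "G (cis t) = g t" if "t \<in> {0..2*pi}" for t
  proof (cases "t = 2*pi")
    case True
    then show ?thesis using g(2) by (simp add: G_def cis_2pi Arg2pi_of_real[of 1, simplified])
  next
    case False
    then have "Arg2pi (cis t) = t" using that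
      by (intro Arg2pi_unique[of 1]) (auto simp: cis_conv_exp)
    then show ?thesis by (simp add: G_def)
  qed
  have sphere: "z \<in> sphere 0 1 \<longleftrightarrow> z \<in> cis ` {0..2*pi}" for z
  proof
    assume "z \<in> sphere 0 1"
    then have "z = cis (Arg2pi z)" using complex_norm_eq_1_exp[of z] by (simp add: cis_conv_exp)
    then show "z \<in> cis ` {0..2*pi}"
      using Arg2pi_ge_0[of z] Arg2pi_lt_2pi[of z] by (intro image_eqI) auto
  qed auto
  \<comment> \<open>\<open>Arg2pi\<close> jumps at 1, so continuity is not obtained by composition.
    The preimage of a closed set is instead the image under \<open>cis\<close> of a compact set of
    parameters; this uses that \<open>g\<close> agrees at both ends.\<close>
  have "continuous_on (sphere 0 1) G"
    unfolding continuous_on_closed_vimage[OF closed_sphere]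
  proof (intro allI impI)
    fix B :: "real set" assume "closed B"
    have "G -` B \<inter> sphere 0 1 = cis ` ({0..2*pi} \<inter> ({0..2*pi} \<inter> g -` B))"
      using sphere G by auto
    moreover have "compact ({0..2*pi} \<inter> ({0..2*pi} \<inter> g -` B))"
      by (intro compact_Int_closed compact_Icc continuous_closed_preimage g closed_atLeastAtMost \<open>closed B\<close>)
    then have "compact (cis ` ({0..2*pi} \<inter> ({0..2*pi} \<inter> g -` B)))"
      by (intro compact_continuous_image continuous_intros)
    ultimately show "closed (G -` B \<inter> sphere 0 1)" by (simp only: compact_imp_closed)
  qed
  then obtain h where h: "real_polynomial_function h" "\<And>z. z \<in> sphere 0 1 \<Longrightarrow> \<bar>G z - h z\<bar> < e"
    using Stone_Weierstrass_real_polynomial_function[of "sphere 0 1" G e] e by auto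
  show ?thesis
  proof (rule that[OF trig_poly_real_polynomial_function[OF h(1)]])
    fix t assume t: "t \<in> {0..2*pi}"
    have "\<bar>G (cis t) - h (cis t)\<bar> < e" by (rule h(2)) simp
    then show "cmod (of_real (h (cis t)) - of_real (g t)) \<le> e"
      by (simp only: G[OF t] norm_of_real abs_minus_commute flip: of_real_diff)
  qed
qed

lemma trig_poly_approx:
  assumes a: "a \<in> C2pi" and e: "e > 0"
  obtains p where "trig_poly p" "\<And>t. t \<in> {0..2*pi} \<Longrightarrow> cmod (p t - a t) \<le> e"
proof -
  have a': "continuous_on {0..2*pi} a" "a 0 = a (2*pi)" using a by (auto simp: C2pi_def)
  have e2: "e / 2 > 0" using e by simp
  obtain p where p: "trig_poly p" "\<And>t. t \<in> {0..2*pi} \<Longrightarrow> cmod (p t - of_real (Re (a t))) \<le> e / 2"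
    using trig_poly_approx_real[OF continuous_on_Re[OF a'(1)] _ e2] a'(2) by metis
  obtain q where q: "trig_poly q" "\<And>t. t \<in> {0..2*pi} \<Longrightarrow> cmod (q t - of_real (Im (a t))) \<le> e / 2"
    using trig_poly_approx_real[OF continuous_on_Im[OF a'(1)] _ e2] a'(2) by metis
  show ?thesis
  proof (rule that[of "\<lambda>t. p t + \<i> * q t"])
    show "trig_poly (\<lambda>t. p t + \<i> * q t)" by (intro trig_poly_add trig_poly_mult trig_poly_const p q)
    fix t assume t: "t \<in> {0..2*pi}"
    have "p t + \<i> * q t - a t = (p t - of_real (Re (a t))) + \<i> * (q t - of_real (Im (a t)))"
      using complex_eq[of "a t"] by (simp add: algebra_simps)
    also have "cmod \<dots> \<le> e / 2 + e / 2"
      by (rule order_trans[OF norm_triangle_ineq], unfold norm_mult) (use p(2)[OF t] q(2)[OF t] in simp)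
    finally show "cmod (p t + \<i> * q t - a t) \<le> e" by simp
  qed
qed

lemma trig_poly_eq_trig_sum:
  assumes "trig_poly p"
  obtains N M u where "\<And>t. p t = trig_sum N u t * cis (real M * t)"
proof -
  obtain M P where p: "\<And>t. p t = poly P (cis (- t)) * cis (real M * t)"
    using assms unfolding trig_poly_def by blast
  have "poly P (cis (- t)) = trig_sum (Suc (degree P)) (coeff P) t" for t
    unfolding trig_sum_def poly_altdef lessThan_Suc_atMost by (simp add: Complex.DeMoivre)
  then show ?thesis using p by (intro that) simp
qed

lemma trig_poly_continuous:
  assumes "trig_poly p" shows "continuous_on S p"
proof -
  obtain N M u where "\<And>t. p t = trig_sum N u t * cis (real M * t)"
    using assms by (rule trig_poly_eq_trig_sum) blast
  then have "p = (\<lambda>t. trig_sum N u t * cis (real M * t))" by blast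
  then show ?thesis by (simp only:) (intro continuous_intros)
qed

section \<open>The spectrum of a self-adjoint Toeplitz operator\<close>

text \<open>A lower bound for \<open>T(b)\<close> gives \<open>\<integral> (\<bar>b\<bar>\<^sup>2 - c\<^sup>2) \<bar>p\<bar>\<^sup>2 \<ge> 0\<close> for all trigonometric polynomials,
  since multiplication by \<open>cis (M t)\<close> does not change \<open>\<bar>p\<bar>\<close>; by density this may be tested with
  \<open>p\<^sup>2\<close> the positive part of \<open>c\<^sup>2 - \<bar>b\<bar>\<^sup>2\<close>.\<close>

lemma mean_nonneg_trig_poly:
  assumes b: "continuous_on {0..2*pi} b" and c: "c > 0" "\<And>x. c * norm x \<le> norm (toeplitz b x)"
    and p: "trig_poly p"
  shows "0 \<le> mean (\<lambda>t. ((cmod (b t))\<^sup>2 - c\<^sup>2) * (cmod (p t))\<^sup>2)"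
proof -
  obtain N M u where p: "\<And>t. p t = trig_sum N u t * cis (real M * t)"
    using p by (rule trig_poly_eq_trig_sum) blast
  let ?s = "trig_sum N u"
  have "c\<^sup>2 * (norm (fin_ell2 N u))\<^sup>2 \<le> (norm (toeplitz b (fin_ell2 N u)))\<^sup>2"
    using power_mono[OF c(2)[of "fin_ell2 N u"], of 2] c(1) by (simp add: power_mult_distrib)
  also have "\<dots> \<le> mean (\<lambda>t. (cmod (b t * ?s t))\<^sup>2)" by (rule norm_toeplitz_fin_le[OF b])
  finally have "c\<^sup>2 * mean (\<lambda>t. (cmod (?s t))\<^sup>2) \<le> mean (\<lambda>t. (cmod (b t * ?s t))\<^sup>2)"
    by (simp only: norm_fin_ell2 parseval_trig_sum)
  moreover have "c\<^sup>2 * mean (\<lambda>t. (cmod (?s t))\<^sup>2) = mean (\<lambda>t. c\<^sup>2 * (cmod (?s t))\<^sup>2)"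
    by (intro mean_mult_left[symmetric] continuous_intros)
  moreover have "mean (\<lambda>t. (cmod (b t * ?s t))\<^sup>2 - c\<^sup>2 * (cmod (?s t))\<^sup>2)
      = mean (\<lambda>t. (cmod (b t * ?s t))\<^sup>2) - mean (\<lambda>t. c\<^sup>2 * (cmod (?s t))\<^sup>2)"
    by (intro mean_diff continuous_intros b)
  ultimately have "0 \<le> mean (\<lambda>t. (cmod (b t * ?s t))\<^sup>2 - c\<^sup>2 * (cmod (?s t))\<^sup>2)" by simp
  moreover have "(cmod (b t * ?s t))\<^sup>2 - c\<^sup>2 * (cmod (?s t))\<^sup>2 = ((cmod (b t))\<^sup>2 - c\<^sup>2) * (cmod (p t))\<^sup>2" for t
    by (simp add: p norm_mult power_mult_distrib left_diff_distrib)
  ultimately show ?thesis by (simp only:)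
qed

text \<open>Applied to \<open>a - z\<close> with \<open>z\<close> a value of \<open>a\<close>, this
  excludes every positive lower bound for \<open>T(a) - z\<close>.\<close>

lemma symbol_bounded_below:
  assumes b: "b \<in> C2pi" and c: "c > 0" "\<And>x. c * norm x \<le> norm (toeplitz b x)"
    and t0: "t0 \<in> {0..2*pi}"
  shows "c \<le> cmod (b t0)"
proof -
  have b': "continuous_on {0..2*pi} b" "b 0 = b (2*pi)" using b by (auto simp: C2pi_def)
  define h where "h t = (cmod (b t))\<^sup>2 - c\<^sup>2" for t
  define g where "g t = sqrt (max 0 (- h t))" for t
  have h: "continuous_on {0..2*pi} h" unfolding h_def by (intro continuous_intros b')
  have g: "continuous_on {0..2*pi} g" unfolding g_def by (intro continuous_intros h)
  have g0: "g 0 = g (2*pi)" by (simp add: g_def h_def b')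
  have g2: "(g t)\<^sup>2 = max 0 (- h t)" "0 \<le> g t" for t by (simp_all add: g_def)
  obtain H where H: "H > 0" "\<And>t. t \<in> {0..2*pi} \<Longrightarrow> \<bar>h t\<bar> \<le> H"
    using continuous_bound[OF h] by auto
  obtain G where G: "G > 0" "\<And>t. t \<in> {0..2*pi} \<Longrightarrow> \<bar>g t\<bar> \<le> G"
    using continuous_bound[OF g] by auto
  have hg: "continuous_on {0..2*pi} (\<lambda>t. h t * (g t)\<^sup>2)" by (intro continuous_intros h g)
  have "0 \<le> mean (\<lambda>t. h t * (g t)\<^sup>2)"
  proof (rule field_le_epsilon)
    fix d :: real assume "d > 0"
    \<comment> \<open>The 1 gives \<open>r + g t \<le> 2 * G + 1\<close>; the other entry makes the
      resulting error \<open>H * (e * (2 * G + 1))\<close> at most \<open>d\<close>.\<close>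
    define e where "e = min 1 (d / (H * (2 * G + 1)))"
    have e: "e > 0" "e \<le> 1" using \<open>d > 0\<close> H G by (auto simp: e_def)
    have "H * (e * (2 * G + 1)) \<le> H * ((d / (H * (2 * G + 1))) * (2 * G + 1))"
      using H G by (intro mult_left_mono mult_right_mono) (auto simp: e_def)
    also have "\<dots> = d" using H G by (simp add: field_simps add_pos_pos less_imp_neq[symmetric])
    finally have ed: "H * (e * (2 * G + 1)) \<le> d" .
    obtain p where p: "trig_poly p" "\<And>t. t \<in> {0..2*pi} \<Longrightarrow> cmod (p t - of_real (g t)) \<le> e"
      using trig_poly_approx_real[OF g g0 e(1)] by blast
    have hp: "continuous_on {0..2*pi} (\<lambda>t. h t * (cmod (p t))\<^sup>2)"
      by (intro continuous_intros h trig_poly_continuous p)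
    have "0 \<le> mean (\<lambda>t. h t * (cmod (p t))\<^sup>2)"
      unfolding h_def by (rule mean_nonneg_trig_poly[OF b'(1) c p(1)])
    also have "\<dots> \<le> mean (\<lambda>t. h t * (g t)\<^sup>2 + d)"
    proof (rule mean_mono[OF hp])
      show "continuous_on {0..2*pi} (\<lambda>t. h t * (g t)\<^sup>2 + d)" by (intro continuous_intros hg)
      fix t assume t: "t \<in> {0..2*pi}"
      define r where "r = cmod (p t)"
      have "\<bar>r - g t\<bar> \<le> e"
        using norm_triangle_ineq3[of "p t" "of_real (g t)"] p(2)[OF t] g2(2)[of t]
          by (simp add: r_def)
      moreover have "r + g t \<le> 2 * G + 1" "0 \<le> r + g t"
        using \<open>\<bar>r - g t\<bar> \<le> e\<close> G(2)[OF t] g2(2)[of t] e(2) by (auto simp: r_def)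
      ultimately have "\<bar>r - g t\<bar> * (r + g t) \<le> e * (2 * G + 1)"
        using e by (intro mult_mono) auto
      then have "\<bar>(r - g t) * (r + g t)\<bar> \<le> e * (2 * G + 1)"
        using \<open>0 \<le> r + g t\<close> by (simp add: abs_mult)
      then have "\<bar>h t * ((r - g t) * (r + g t))\<bar> \<le> H * (e * (2 * G + 1))"
        unfolding abs_mult[of "h t"] using H by (intro mult_mono H(2)[OF t]) auto
      moreover have "h t * r\<^sup>2 = h t * (g t)\<^sup>2 + h t * ((r - g t) * (r + g t))"
        by (simp add: algebra_simps power2_eq_square)
      ultimately show "h t * (cmod (p t))\<^sup>2 \<le> h t * (g t)\<^sup>2 + d"
        using ed unfolding r_def[symmetric] by linarith
    qed
    also have "\<dots> = mean (\<lambda>t. h t * (g t)\<^sup>2) + d"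
      using mean_add[OF hg continuous_on_const] by (simp add: mean_const)
    finally show "0 \<le> mean (\<lambda>t. h t * (g t)\<^sup>2) + d" .
  qed
  \<comment> \<open>The integrand is minus the square of the negative part of \<open>h\<close>. As
    its mean is nonnegative, continuity forces that part to vanish everywhere.\<close>
  moreover have sq: "h t * (g t)\<^sup>2 = - (max 0 (- h t))\<^sup>2" for t
    unfolding g2 by (simp add: max_def power2_eq_square)
  moreover have cm: "continuous_on {0..2*pi} (\<lambda>t. (max 0 (- h t))\<^sup>2)" by (intro continuous_intros h)
  moreover have "mean (\<lambda>t. - (max 0 (- h t))\<^sup>2) = - mean (\<lambda>t. (max 0 (- h t))\<^sup>2)"
    using mean_mult_left[OF cm, of "-1"] by simp
  ultimately have "mean (\<lambda>t. (max 0 (- h t))\<^sup>2) \<le> 0" by simp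
  then have "integral {0..2*pi} (\<lambda>t. (max 0 (- h t))\<^sup>2) \<le> 0"
    by (simp add: mean_def field_simps mult_le_0_iff)
  moreover have "0 \<le> integral {0..2*pi} (\<lambda>t. (max 0 (- h t))\<^sup>2)"
    by (intro integral_nonneg integrable_continuous_interval cm) simp
  ultimately have "(max 0 (- h t0))\<^sup>2 = 0"
    using integral_eq_0_iff[OF cm] t0 by auto
  then have "c\<^sup>2 \<le> (cmod (b t0))\<^sup>2" by (simp add: h_def max_def split: if_splits)
  then show ?thesis by (rule power2_le_imp_le) simp
qed

lemma C2pi_diff_const: "a \<in> C2pi \<Longrightarrow> (\<lambda>t. a t - z) \<in> C2pi"
  by (auto simp: C2pi_def intro: continuous_intros)

lemma toeplitz_diff_const:
  "continuous_on {0..2*pi} a \<Longrightarrow> toeplitz (\<lambda>t. a t - z) x = toeplitz a x - z *\<^sub>C x"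
  by (simp add: toeplitz_diff toeplitz_const)

text \<open>The range of a real continuous function on an interval is an interval, so enclosing the
  spectrum between its minimum and maximum loses nothing.\<close>

lemma spectrum_toeplitz:
  assumes a: "a \<in> C2pi" and real: "\<And>t. t \<in> {0..2*pi} \<Longrightarrow> a t \<in> \<real>"
  shows "spectrum (toeplitz a) = a ` {0..2*pi}"
proof
  have ac: "continuous_on {0..2*pi} a" using a by (simp add: C2pi_def)
  have "\<exists>m M. (\<lambda>t. Re (a t)) ` {0..2*pi} = {m..M} \<and> m \<le> M"
    by (rule continuous_image_closed_interval) (auto intro!: continuous_intros ac)
  then obtain m M where mM: "(\<lambda>t. Re (a t)) ` {0..2*pi} = {m..M}" by blast
  have bounds: "m \<le> Re (a t) \<and> Re (a t) \<le> M" if "t \<in> {0..2*pi}" for t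
    using imageI[OF that, of "\<lambda>t. Re (a t)"] unfolding mM by simp
  have "spectrum (toeplitz a) \<subseteq> of_real ` {m..M}"
    using toeplitz_numerical_range[OF ac bounds]
    by (intro spectrum_subset_numerical_range self_adjoint_toeplitz ac real)
  also have "\<dots> = (\<lambda>t. of_real (Re (a t))) ` {0..2*pi}"
    unfolding mM[symmetric] image_image ..
  also have "\<dots> = a ` {0..2*pi}" by (intro image_cong refl) (simp add: real)
  finally show "spectrum (toeplitz a) \<subseteq> a ` {0..2*pi}" .
  show "a ` {0..2*pi} \<subseteq> spectrum (toeplitz a)"
  proof
    fix z assume "z \<in> a ` {0..2*pi}"
    then obtain t where t: "t \<in> {0..2*pi}" "z = a t" by blast
    show "z \<in> spectrum (toeplitz a)"
    proof (rule ccontr)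
      assume "z \<notin> spectrum (toeplitz a)"
      then have "invertible_op (\<lambda>x. toeplitz a x - z *\<^sub>C x)" by (simp add: spectrum_def)
      then obtain D where D: "D > 0" "\<And>x. norm x \<le> D * norm (toeplitz a x - z *\<^sub>C x)"
        by (rule invertible_op_bounded_below) blast
      have "1 / D \<le> cmod (a t - z)"
      proof (rule symbol_bounded_below[OF C2pi_diff_const[OF a] _ _ t(1)])
        show "1 / D * norm x \<le> norm (toeplitz (\<lambda>t. a t - z) x)" for x
          using D by (simp add: toeplitz_diff_const[OF ac] field_simps)
      qed (use D in simp)
      then show False using D t by (simp add: field_simps)
    qed
  qed
qed

section \<open>Compact operators\<close>

lemma compact_opD: "compact_op K \<Longrightarrow> bounded_op K"
  by (simp add: compact_op_def)

lemma compact_op_if_image_subset: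
  assumes "bounded_op K" "K ` cball 0 1 \<subseteq> S" "compact S"
  shows "compact_op K"
proof -
  have "closure (K ` cball 0 1) \<subseteq> S" by (intro closure_minimal assms compact_imp_closed)
  then have "compact (closure (K ` cball 0 1))"
    using compact_Int_closed[OF assms(3) closed_closure] by (metis Int_absorb1)
  then show ?thesis using assms(1) by (simp add: compact_op_def)
qed

lemma compact_op_zero: "compact_op (\<lambda>x. 0)"
  by (rule compact_op_if_image_subset[where S = "{0}"]) auto

lemma compact_op_add:
  assumes "compact_op K" "compact_op L" shows "compact_op (\<lambda>x. K x + L x)"
proof (rule compact_op_if_image_subset)
  let ?S = "closure (K ` cball 0 1)" and ?T = "closure (L ` cball 0 1)"
  show "compact {x + y | x y. x \<in> ?S \<and> y \<in> ?T}"
    using assms by (intro compact_sums) (auto simp: compact_op_def)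
  show "(\<lambda>x. K x + L x) ` cball 0 1 \<subseteq> {x + y | x y. x \<in> ?S \<and> y \<in> ?T}"
    using closure_subset by blast
  show "bounded_op (\<lambda>x. K x + L x)" by (intro bounded_op_add compact_opD assms)
qed

lemma compact_op_sum:
  "finite I \<Longrightarrow> (\<And>i. i \<in> I \<Longrightarrow> compact_op (K i)) \<Longrightarrow> compact_op (\<lambda>x. \<Sum>i\<in>I. K i x)"
  by (induction I rule: finite_induct) (auto intro: compact_op_zero compact_op_add)

lemma compact_op_compose_left:
  assumes B: "bounded_op B" and K: "compact_op K" shows "compact_op (\<lambda>x. B (K x))"
proof (rule compact_op_if_image_subset)
  show "compact (B ` closure (K ` cball 0 1))"
    using K bounded_opD(1)[OF B]
    by (intro compact_continuous_image linear_continuous_on) (auto simp: compact_op_def)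
  show "(\<lambda>x. B (K x)) ` cball 0 1 \<subseteq> B ` closure (K ` cball 0 1)"
    by (intro image_subsetI imageI subsetD[OF closure_subset])
  show "bounded_op (\<lambda>x. B (K x))" by (rule bounded_op_compose[OF B compact_opD[OF K]])
qed

lemma compact_op_limit:
  assumes "\<And>e. e > 0 \<Longrightarrow> \<exists>C. compact_op C \<and> (\<forall>x. norm (C x - K x) \<le> e * norm x)"
  shows "compact_op K"
  unfolding compact_op_def compact_eq_totally_bounded
proof (intro conjI allI impI)
  show "bounded_op K"
  proof (rule bounded_op_limit)
    fix e :: real assume "e > 0"
    then obtain C where "compact_op C" "\<forall>x. norm (C x - K x) \<le> e * norm x"
      using assms[OF \<open>e > 0\<close>] by (elim exE conjE)
    then show "\<exists>C. bounded_op C \<and> (\<forall>x. norm (C x - K x) \<le> e * norm x)"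
      by (intro exI conjI compact_opD)
  qed
  show "complete (closure (K ` cball 0 1))" by (simp add: complete_eq_closed)
  fix e :: real assume e: "e > 0"
  then obtain C where C: "compact_op C" "\<And>x. norm (C x - K x) \<le> e / 4 * norm x"
    using assms[of "e / 4"] by auto
  have "compact (closure (C ` cball 0 1))" using C(1) by (simp add: compact_op_def)
  then obtain k where k: "finite k" "closure (C ` cball 0 1) \<subseteq> (\<Union>x\<in>k. ball x (e / 4))"
    unfolding compact_eq_totally_bounded using e by (meson divide_pos_pos zero_less_numeral)
  \<comment> \<open>A finite \<open>e / 4\<close>-net for the image under \<open>C\<close> serves
    for \<open>K\<close> with radius \<open>e / 2\<close>. Closed balls let the inclusion pass to
    the closure before the radius is enlarged to \<open>e\<close>.\<close>
  have "K ` cball 0 1 \<subseteq> (\<Union>x\<in>k. cball x (e / 2))"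
  proof safe
    fix y :: ell2 assume y: "y \<in> cball 0 1"
    have "C y \<in> closure (C ` cball 0 1)" by (intro subsetD[OF closure_subset] imageI y)
    then obtain x where x: "x \<in> k" "dist x (C y) < e / 4" using k(2) by auto
    have "dist (C y) (K y) \<le> e / 4 * norm y" using C(2) by (simp add: dist_norm)
    also have "\<dots> \<le> e / 4 * 1" using y e by (intro mult_left_mono) auto
    finally have "dist x (K y) \<le> e / 2" using dist_triangle[of x "K y" "C y"] x(2) by simp
    then show "K y \<in> (\<Union>x\<in>k. cball x (e / 2))" using x(1) by auto
  qed
  then have "closure (K ` cball 0 1) \<subseteq> (\<Union>x\<in>k. cball x (e / 2))"
    by (intro closure_minimal) (auto intro!: closed_UN k(1))
  also have "\<dots> \<subseteq> (\<Union>x\<in>k. ball x e)" using e by fastforce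
  finally show "\<exists>k. finite k \<and> closure (K ` cball 0 1) \<subseteq> (\<Union>x\<in>k. ball x e)" using k(1) by blast
qed

lemma compact_op_rank_one:
  assumes A: "bounded_op A" shows "compact_op (\<lambda>x. ell2_nth (A x) i *\<^sub>C y)"
proof (rule compact_op_if_image_subset)
  have le: "cmod (ell2_nth (A x) i) \<le> onorm A * norm x" for x
    by (rule order_trans[OF norm_ell2_nth_le bounded_opD(6)[OF A]])
  show "compact ((\<lambda>c. c *\<^sub>C y) ` cball 0 (onorm A))"
    by (intro compact_continuous_image compact_cball linear_continuous_on bounded_linear_scaleC_left)
  show "(\<lambda>x. ell2_nth (A x) i *\<^sub>C y) ` cball 0 1 \<subseteq> (\<lambda>c. c *\<^sub>C y) ` cball 0 (onorm A)"
  proof (intro image_subsetI imageI)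
    fix x :: ell2 assume "x \<in> cball 0 1"
    then have "onorm A * norm x \<le> onorm A"
      using bounded_opD(7)[OF A] by (simp add: mult_left_le)
    then show "ell2_nth (A x) i \<in> cball 0 (onorm A)" using le[of x] by simp
  qed
  show "bounded_op (\<lambda>x. ell2_nth (A x) i *\<^sub>C y)"
  proof (rule bounded_op_intro[where C = "onorm A * norm y"])
    show "norm (ell2_nth (A x) i *\<^sub>C y) \<le> onorm A * norm y * norm x" for x
      using mult_right_mono[OF le[of x] norm_ge_zero[of y]] by (simp add: norm_scaleC mult_ac)
  qed (simp_all add: bounded_opD[OF A] scaleC_distribs)
qed

lemma ell2_nth_sum: "ell2_nth (\<Sum>i\<in>I. f i) n = (\<Sum>i\<in>I. ell2_nth (f i) n)"
  by (induction I rule: infinite_finite_induct) auto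

lemma compact_op_finitely_many_rows:
  assumes A: "bounded_op A" and rows: "\<And>x i. i \<ge> N \<Longrightarrow> ell2_nth (A x) i = 0"
  shows "compact_op A"
proof -
  define \<delta> where "\<delta> i = fin_ell2 (Suc i) (\<lambda>n. if n = i then 1 else 0)" for i
  have "A x = (\<Sum>i<N. ell2_nth (A x) i *\<^sub>C \<delta> i)" for x
  proof (rule ell2_eqI)
    fix n
    have "ell2_nth (\<Sum>i<N. ell2_nth (A x) i *\<^sub>C \<delta> i) n = (\<Sum>i<N. if i = n then ell2_nth (A x) i else 0)"
      unfolding ell2_nth_sum by (intro sum.cong refl) (auto simp: \<delta>_def)
    then show "ell2_nth (A x) n = ell2_nth (\<Sum>i<N. ell2_nth (A x) i *\<^sub>C \<delta> i) n"
      using rows[of n x] by simp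
  qed
  then have "A = (\<lambda>x. \<Sum>i<N. ell2_nth (A x) i *\<^sub>C \<delta> i)" by blast
  moreover have "compact_op (\<lambda>x. \<Sum>i<N. ell2_nth (A x) i *\<^sub>C \<delta> i)"
    by (intro compact_op_sum compact_op_rank_one A finite_lessThan)
  ultimately show ?thesis by simp
qed

section \<open>Semicommutators of Toeplitz operators\<close>

text \<open>Up to sign a product of two Hankel operators; it measures the failure of
  \<open>T\<close> to be multiplicative.\<close>

definition semicomm :: "(real \<Rightarrow> complex) \<Rightarrow> (real \<Rightarrow> complex) \<Rightarrow> ell2 \<Rightarrow> ell2"
  where "semicomm a b x = toeplitz a (toeplitz b x) - toeplitz (\<lambda>t. a t * b t) x"

lemma bounded_op_semicomm:
  assumes "continuous_on {0..2*pi} a" "continuous_on {0..2*pi} b"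
  shows "bounded_op (semicomm a b)"
  unfolding semicomm_def
  by (intro bounded_op_diff bounded_op_compose[OF bounded_op_toeplitz bounded_op_toeplitz]
      bounded_op_toeplitz continuous_intros assms)

lemma semicomm_add:
  assumes "continuous_on {0..2*pi} a" "continuous_on {0..2*pi} a'" "continuous_on {0..2*pi} b"
  shows "semicomm (\<lambda>t. a t + a' t) b x = semicomm a b x + semicomm a' b x"
  using assms by (simp add: semicomm_def distrib_right toeplitz_add continuous_on_mult)

lemma semicomm_cmult:
  assumes "continuous_on {0..2*pi} a" "continuous_on {0..2*pi} b"
  shows "semicomm (\<lambda>t. c * a t) b x = c *\<^sub>C semicomm a b x"
  using assms
    by (simp add: semicomm_def mult.assoc toeplitz_cmult continuous_on_mult scaleC_distribs)

text \<open>For \<open>a t = cis (k t)\<close> the matrix of \<open>T(a)\<close> is a shift, and all but the first \<open>-k\<close> rows of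
  \<open>T(a) T(b)\<close> and \<open>T(a b)\<close> agree.\<close>

lemma compact_op_semicomm_cis:
  assumes b: "continuous_on {0..2*pi} b"
  shows "compact_op (semicomm (\<lambda>t. cis (of_int k * t)) b)"
proof (rule compact_op_finitely_many_rows)
  show "bounded_op (semicomm (\<lambda>t. cis (of_int k * t)) b)"
    by (intro bounded_op_semicomm continuous_intros b)
  fix x i assume i: "nat (- k) \<le> i"
  then have k: "0 \<le> int i + k" by linarith
  have c: "continuous_on {0..2*pi} (\<lambda>t. cis (of_int k * t) * b t)" by (intro continuous_intros b)
  show "ell2_nth (semicomm (\<lambda>t. cis (of_int k * t)) b x) i = 0"
    using k by (simp add: semicomm_def toeplitz_cis_nth ell2_nth_toeplitz[OF b] ell2_nth_toeplitz[OF c]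
        fourier_coeff_shift diff_diff_eq)
qed

lemma compact_op_semicomm_trig_poly:
  assumes p: "trig_poly p" and b: "continuous_on {0..2*pi} b"
  shows "compact_op (semicomm p b)"
proof -
  obtain N M u where p: "\<And>t. p t = trig_sum N u t * cis (real M * t)"
    using p by (rule trig_poly_eq_trig_sum) blast
  \<comment> \<open>The common exponential is absorbed into each term, which gives the frequencies
    \<open>M, M - 1, ...\<close> and an induction on the number of terms.\<close>
  define q where "q n t = (\<Sum>j<n. u j * cis (of_int (int M - int j) * t))" for n t
  have q: "continuous_on {0..2*pi} (q n)" for n unfolding q_def by (intro continuous_intros)
  have "compact_op (semicomm (q n) b)" for n
  proof (induction n)
    case 0
    have "q 0 = (\<lambda>t. 0)" by (simp add: q_def fun_eq_iff)
    then have "semicomm (q 0) b x = 0" for x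
      by (simp add: semicomm_def toeplitz_const)
    then have "semicomm (q 0) b = (\<lambda>x. 0)" by blast
    then show ?case by (simp add: compact_op_zero)
  next
    case (Suc n)
    let ?e = "\<lambda>t. cis (of_int (int M - int n) * t)"
    have e: "continuous_on {0..2*pi} ?e" by (intro continuous_intros)
    have "semicomm (q (Suc n)) b x = semicomm (q n) b x + u n *\<^sub>C semicomm ?e b x" for x
    proof -
      have "q (Suc n) = (\<lambda>t. q n t + u n * ?e t)" by (simp add: q_def fun_eq_iff)
      then show ?thesis
        by (simp only: semicomm_add[OF q continuous_on_mult_left[OF e] b] semicomm_cmult[OF e b])
    qed
    then have "semicomm (q (Suc n)) b = (\<lambda>x. semicomm (q n) b x + u n *\<^sub>C semicomm ?e b x)" by blast
    moreover have "compact_op (\<lambda>x. semicomm (q n) b x + u n *\<^sub>C semicomm ?e b x)"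
      by (rule compact_op_add[OF Suc compact_op_compose_left[OF bounded_op_scaleC[OF bounded_op_ident]
            compact_op_semicomm_cis[OF b]]])
    ultimately show ?case by simp
  qed
  moreover have "p = q N"
    unfolding fun_eq_iff p trig_sum_def q_def sum_distrib_right mult.assoc cis_mult
    by (simp add: left_diff_distrib)
  ultimately show ?thesis by simp
qed

text \<open>Linearity in the first symbol turns the error into the semicommutator of
  \<open>p - a\<close> and \<open>b\<close>. Each of its two terms is bounded by
  \<open>d * C * norm x\<close>, whence \<open>d = e / (2 * C)\<close>.\<close>

lemma compact_op_semicomm:
  assumes a: "a \<in> C2pi" and b: "continuous_on {0..2*pi} b"
  shows "compact_op (semicomm a b)"
proof (rule compact_op_limit)
  fix e :: real assume e: "e > 0"
  have ac: "continuous_on {0..2*pi} a" using a by (simp add: C2pi_def)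
  obtain C where C: "C > 0" "\<And>t. t \<in> {0..2*pi} \<Longrightarrow> cmod (b t) \<le> C"
    using continuous_bound[OF b] by blast
  define d where "d = e / (2 * C)"
  have d: "d > 0" using e C by (simp add: d_def)
  obtain p where p: "trig_poly p" "\<And>t. t \<in> {0..2*pi} \<Longrightarrow> cmod (p t - a t) \<le> d"
    using trig_poly_approx[OF a d] by blast
  have pc: "continuous_on {0..2*pi} p" by (rule trig_poly_continuous[OF p(1)])
  have r: "continuous_on {0..2*pi} (\<lambda>t. p t - a t)" by (intro continuous_intros pc ac)
  have "norm (semicomm p b x - semicomm a b x) \<le> e * norm x" for x
  proof -
    have "semicomm p b x = semicomm (\<lambda>t. p t - a t) b x + semicomm a b x"
      using semicomm_add[OF r ac b] by simp
    then have "semicomm p b x - semicomm a b x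
        = toeplitz (\<lambda>t. p t - a t) (toeplitz b x) - toeplitz (\<lambda>t. (p t - a t) * b t) x"
      by (simp add: semicomm_def)
    also have "norm \<dots> \<le> d * (C * norm x) + d * C * norm x"
    proof (rule order_trans[OF norm_triangle_ineq4], rule add_mono)
      have "norm (toeplitz (\<lambda>t. p t - a t) (toeplitz b x)) \<le> d * norm (toeplitz b x)"
        by (rule norm_toeplitz_le[OF r p(2)])
      also have "\<dots> \<le> d * (C * norm x)"
        using d by (intro mult_left_mono norm_toeplitz_le[OF b C(2)]) auto
      finally show "norm (toeplitz (\<lambda>t. p t - a t) (toeplitz b x)) \<le> d * (C * norm x)" .
      show "norm (toeplitz (\<lambda>t. (p t - a t) * b t) x) \<le> d * C * norm x"
        by (rule norm_toeplitz_le)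
           (use d C in \<open>auto intro!: continuous_intros pc ac b mult_mono p(2) simp: norm_mult\<close>)
    qed
    also have "\<dots> = e * norm x" using C by (simp add: d_def)
    finally show ?thesis .
  qed
  then show "\<exists>C. compact_op C \<and> (\<forall>x. norm (C x - semicomm a b x) \<le> e * norm x)"
    using compact_op_semicomm_trig_poly[OF p(1) b] by blast
qed

text \<open>Constant terms cancel because \<open>T(c) = c\<close>. What remains is
  \<open>T(a)\<close> times the compact error for \<open>p\<close>, plus the semicommutator of
  \<open>a\<close> and \<open>p \<circ> a\<close>.\<close>

lemma compact_op_poly_toeplitz:
  assumes a: "a \<in> C2pi"
  shows "compact_op (\<lambda>x. poly_op p (toeplitz a) x - toeplitz (\<lambda>t. poly p (a t)) x)"
proof (induction p)
  case 0
  then show ?case by (simp add: toeplitz_const compact_op_zero)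
next
  case (pCons c p)
  have ac: "continuous_on {0..2*pi} a" using a by (simp add: C2pi_def)
  note bT = bounded_op_toeplitz[OF ac]
  let ?q = "\<lambda>t. poly p (a t)"
  have q: "continuous_on {0..2*pi} ?q" by (intro continuous_intros ac)
  have "poly_op (pCons c p) (toeplitz a) x - toeplitz (\<lambda>t. poly (pCons c p) (a t)) x
      = toeplitz a (poly_op p (toeplitz a) x - toeplitz ?q x) + semicomm a ?q x" for x
    using toeplitz_add[OF continuous_on_const continuous_on_mult[OF ac q], of c x]
    by (simp add: poly_op_pCons[OF bT] bounded_opD[OF bT] semicomm_def toeplitz_const)
  moreover have "compact_op (\<lambda>x. toeplitz a (poly_op p (toeplitz a) x - toeplitz ?q x) + semicomm a ?q x)"
    by (rule compact_op_add[OF compact_op_compose_left[OF bT pCons.IH] compact_op_semicomm[OF a q]])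
  ultimately show ?case by (simp only:)
qed

lemma self_adjoint_diff: "self_adjoint A \<Longrightarrow> self_adjoint B \<Longrightarrow> self_adjoint (\<lambda>x. A x - B x)"
  by (auto simp: self_adjoint_iff inner_diff_left inner_diff_right)

theorem theorem6:
  fixes a :: "real \<Rightarrow> complex" and f :: "complex \<Rightarrow> complex"
  assumes "a \<in> C2pi"
    and "\<forall>t\<in>{0..2*pi}. a t \<in> \<real>"
    and "continuous_on (spectrum (toeplitz a)) f"
  shows "\<exists>K. compact_op K \<and>
    (\<forall>x. cont_fun_calc f (toeplitz a) x = toeplitz (f \<circ> a) x + K x) \<and>
    ((\<forall>z\<in>spectrum (toeplitz a). f z \<in> \<real>) \<longrightarrow>
      self_adjoint K \<and>
      spectrum (cont_fun_calc f (toeplitz a)) = spectrum (toeplitz (f \<circ> a)))"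
proof -
  let ?A = "toeplitz a" and ?B = "cont_fun_calc f (toeplitz a)"
  have ac: "continuous_on {0..2*pi} a" and a0: "a 0 = a (2*pi)"
    using assms(1) by (auto simp: C2pi_def)
  have A: "self_adjoint ?A" using assms(2) by (intro self_adjoint_toeplitz ac) blast
  have spec: "spectrum ?A = a ` {0..2*pi}" using assms(1,2) by (intro spectrum_toeplitz) auto
  have nonempty: "spectrum ?A \<noteq> {}" unfolding spec by simp
  have compact: "compact (spectrum ?A)"
    unfolding spec by (intro compact_continuous_image ac compact_Icc)
  note calc = A nonempty compact
  have spec_real: "spectrum ?A \<subseteq> \<real>" unfolding spec using assms(2) by blast
  have fc: "continuous_on {0..2*pi} (f \<circ> a)"
    using assms(3) unfolding spec by (rule continuous_on_compose[OF ac])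
  have fa: "f \<circ> a \<in> C2pi" using fc a0 by (simp add: C2pi_def)
  define K where "K x = ?B x - toeplitz (f \<circ> a) x" for x
  have "compact_op K"
  proof (rule compact_op_limit)
    fix e :: real assume "e > 0"
    then have e: "e / 2 > 0" by simp
    obtain p where p: "\<And>z. z \<in> spectrum ?A \<Longrightarrow> cmod (poly p z - f z) \<le> e / 2"
      using complex_poly_approx[OF compact spec_real assms(3) e] by blast
    let ?C = "\<lambda>x. poly_op p ?A x - toeplitz (\<lambda>t. poly p (a t)) x"
    have pc: "continuous_on {0..2*pi} (\<lambda>t. poly p (a t))" by (intro continuous_intros ac)
    have "norm (?C x - K x) \<le> e * norm x" for x
    proof -
      \<comment> \<open>Since the spectrum is the range of \<open>a\<close>, the same
        \<open>e / 2\<close> bounds both \<open>p(A) - f(A)\<close> and the symbol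
        \<open>p \<circ> a - f \<circ> a\<close>.\<close>
      have "?C x - K x = (poly_op p ?A x - ?B x) - toeplitz (\<lambda>t. poly p (a t) - (f \<circ> a) t) x"
        unfolding K_def toeplitz_diff[OF pc fc] by simp
      also have "norm \<dots> \<le> e / 2 * norm x + e / 2 * norm x"
      proof (rule order_trans[OF norm_triangle_ineq4], rule add_mono)
        show "norm (poly_op p ?A x - ?B x) \<le> e / 2 * norm x"
          by (rule cont_fun_calc_poly_bound[OF calc assms(3) p])
        show "norm (toeplitz (\<lambda>t. poly p (a t) - (f \<circ> a) t) x) \<le> e / 2 * norm x"
          by (intro norm_toeplitz_le continuous_on_diff pc fc) (use p spec in auto)
      qed
      finally show ?thesis by (simp add: field_simps)
    qed
    then show "\<exists>C. compact_op C \<and> (\<forall>x. norm (C x - K x) \<le> e * norm x)"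
      using compact_op_poly_toeplitz[OF assms(1), of p] by blast
  qed
  moreover have "self_adjoint K" if "\<forall>z\<in>spectrum ?A. f z \<in> \<real>"
    unfolding K_def using that spec
    by (intro self_adjoint_diff self_adjoint_cont_fun_calc calc assms(3) self_adjoint_toeplitz fc) auto
  moreover have "spectrum ?B = spectrum (toeplitz (f \<circ> a))" if "\<forall>z\<in>spectrum ?A. f z \<in> \<real>"
  proof -
    \<comment> \<open>A missing value \<open>f z\<close> would give \<open>T(a) - z\<close> a
      positive lower bound, although its symbol \<open>a - z\<close> has a zero.\<close>
    have "f ` spectrum ?A \<subseteq> spectrum ?B"
    proof (rule image_subsetI, rule ccontr)
      fix z assume z: "z \<in> spectrum ?A" "f z \<notin> spectrum ?B"
      then obtain c where c: "c > 0" "\<And>x. c * norm x \<le> norm (?A x - z *\<^sub>C x)"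
        by (rule bounded_below_if_not_in_spectrum_cont_fun_calc[OF calc assms(3)]) blast
      obtain t where t: "t \<in> {0..2*pi}" "z = a t" using z(1) unfolding spec by blast
      have "c \<le> cmod (a t - z)"
        by (rule symbol_bounded_below[OF C2pi_diff_const[OF assms(1)] c(1) _ t(1)])
           (simp add: toeplitz_diff_const[OF ac] c(2))
      then show False using c(1) t(2) by simp
    qed
    then have "spectrum ?B = f ` spectrum ?A"
      using spectrum_cont_fun_calc_subset[OF calc assms(3)] by blast
    also have "\<dots> = (f \<circ> a) ` {0..2*pi}" by (simp only: spec image_comp)
    also have "\<dots> = spectrum (toeplitz (f \<circ> a))"
      using that spec by (intro spectrum_toeplitz[symmetric] fa) auto
    finally show ?thesis .
  qed
  ultimately show ?thesis by (intro exI[of _ K]) (auto simp: K_def)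
qed

end
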